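(* Let $f\in H^\infty(\mathbb D)$. Then $f$ is an extreme point of the closed unit ball of $H^\infty(\mathbb D)$ if and only if $f(S_1)$ is an extreme point of the closed unit ball of $F_n^\infty$.
   Context: $F^2(H_n)$ is the full Fock space over an $n$-dimensional Hilbert space with basis $e_1,\dots,e_n$, and $S_1\psi=e_1\otimes\psi$ is the first left creation operator (a pure isometry). $F_n^\infty$ is the WOT-closed algebra generated by the left creation operators $S_1,\dots,S_n$ and the identity, with the operator norm. For $f\in H^\infty(\mathbb D)$, $f(S_1)\in F_n^\infty$ is given by the $H^\infty$ functional calculus of $S_1$, i.e. $f(S_1)=\mathrm{SOT}\text{-}\lim_{r\to1^-}f(rS_1)$. *)

theory Defs
  imports "HOL-Complex_Analysis.Complex_Analysis"
begin

type_synonym vec = "nat list \<Rightarrow> complex"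
type_synonym op = "vec \<Rightarrow> vec"

text \<open>Full Fock space over an n-dimensional Hilbert space: l2 over words in the
letters 0..n-1 (letter i corresponds to the basis vector e_(i+1); the empty word
is the vacuum). Vectors are functions on all lists, vanishing off the words.\<close>

definition words :: "nat \<Rightarrow> nat list set" where
  "words n = {w. \<forall>i\<in>set w. i < n}"

definition zero_vec :: vec where
  "zero_vec = (\<lambda>_. 0)"

definition l2 :: "nat \<Rightarrow> vec set" where
  "l2 n = {\<psi>. (\<forall>w. w \<notin> words n \<longrightarrow> \<psi> w = 0) \<and>
                (\<lambda>w. (cmod (\<psi> w))\<^sup>2) summable_on UNIV}"

definition l2norm :: "vec \<Rightarrow> real" where
  "l2norm \<psi> = sqrt (\<Sum>\<^sub>\<infinity>w. (cmod (\<psi> w))\<^sup>2)"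

definition l2inner :: "vec \<Rightarrow> vec \<Rightarrow> complex" where
  "l2inner \<psi> \<phi> = (\<Sum>\<^sub>\<infinity>w. \<psi> w * cnj (\<phi> w))"

text \<open>Operators are represented as maps vec => vec that are zero off l2 n.\<close>

definition bounded_op :: "nat \<Rightarrow> op \<Rightarrow> bool" where
  "bounded_op n T \<longleftrightarrow>
     (\<forall>\<psi>\<in>l2 n. T \<psi> \<in> l2 n) \<and>
     (\<forall>\<psi>\<in>l2 n. \<forall>\<phi>\<in>l2 n. \<forall>a b. T (\<lambda>w. a * \<psi> w + b * \<phi> w) = (\<lambda>w. a * T \<psi> w + b * T \<phi> w)) \<and>
     (\<exists>C. \<forall>\<psi>\<in>l2 n. l2norm (T \<psi>) \<le> C * l2norm \<psi>) \<and>
     (\<forall>\<psi>. \<psi> \<notin> l2 n \<longrightarrow> T \<psi> = zero_vec)"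

definition opnorm :: "nat \<Rightarrow> op \<Rightarrow> real" where
  "opnorm n T = Sup {l2norm (T \<psi>) | \<psi>. \<psi> \<in> l2 n \<and> l2norm \<psi> \<le> 1}"

definition id_op :: "nat \<Rightarrow> op" where
  "id_op n \<psi> = (if \<psi> \<in> l2 n then \<psi> else zero_vec)"

text \<open>Left creation operator S_(i+1): psi |-> e_(i+1) tensor psi.\<close>
definition creation :: "nat \<Rightarrow> nat \<Rightarrow> op" where
  "creation n i \<psi> = (if \<psi> \<in> l2 n then
      (\<lambda>w. case w of [] \<Rightarrow> 0 | j # v \<Rightarrow> if j = i then \<psi> v else 0)
    else zero_vec)"

inductive_set alg_gen :: "nat \<Rightarrow> op set" for n :: nat where
  gen_id: "id_op n \<in> alg_gen n"
| gen_S: "i < n \<Longrightarrow> creation n i \<in> alg_gen n"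
| gen_add: "A \<in> alg_gen n \<Longrightarrow> B \<in> alg_gen n \<Longrightarrow> (\<lambda>\<psi> w. A \<psi> w + B \<psi> w) \<in> alg_gen n"
| gen_smult: "A \<in> alg_gen n \<Longrightarrow> (\<lambda>\<psi> w. c * A \<psi> w) \<in> alg_gen n"
| gen_comp: "A \<in> alg_gen n \<Longrightarrow> B \<in> alg_gen n \<Longrightarrow> A \<circ> B \<in> alg_gen n"

definition wot_closure :: "nat \<Rightarrow> op set \<Rightarrow> op set" where
  "wot_closure n \<A> = {T. bounded_op n T \<and>
     (\<forall>P \<epsilon>. finite P \<and> P \<subseteq> l2 n \<times> l2 n \<and> \<epsilon> > 0 \<longrightarrow>
        (\<exists>B\<in>\<A>. \<forall>(x, y)\<in>P. cmod (l2inner (T x) y - l2inner (B x) y) < \<epsilon>))}"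

definition Fn_inf :: "nat \<Rightarrow> op set" where
  "Fn_inf n = wot_closure n (alg_gen n)"

definition Fn_ball :: "nat \<Rightarrow> op set" where
  "Fn_ball n = {T \<in> Fn_inf n. opnorm n T \<le> 1}"

definition extreme_Fn :: "nat \<Rightarrow> op \<Rightarrow> bool" where
  "extreme_Fn n T \<longleftrightarrow> T \<in> Fn_ball n \<and>
     \<not> (\<exists>A\<in>Fn_ball n. \<exists>B\<in>Fn_ball n. \<exists>t::real. 0 < t \<and> t < 1 \<and> A \<noteq> B \<and>
           T = (\<lambda>\<psi> w. (1 - t) * A \<psi> w + t * B \<psi> w))"

text \<open>H^infinity of the disc; functions are normalised to be 0 off the open disc.\<close>
definition Hinf :: "(complex \<Rightarrow> complex) set" where
  "Hinf = {f. f holomorphic_on ball 0 1 \<and> bounded (f ` ball 0 1) \<and>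
              (\<forall>z. z \<notin> ball 0 1 \<longrightarrow> f z = 0)}"

definition Hinf_ball :: "(complex \<Rightarrow> complex) set" where
  "Hinf_ball = {f \<in> Hinf. \<forall>z\<in>ball 0 1. cmod (f z) \<le> 1}"

definition extreme_Hinf :: "(complex \<Rightarrow> complex) \<Rightarrow> bool" where
  "extreme_Hinf f \<longleftrightarrow> f \<in> Hinf_ball \<and>
     \<not> (\<exists>g\<in>Hinf_ball. \<exists>h\<in>Hinf_ball. \<exists>t::real. 0 < t \<and> t < 1 \<and> g \<noteq> h \<and>
           f = (\<lambda>z. (1 - t) * g z + t * h z))"

definition l2_tendsto :: "('a \<Rightarrow> vec) \<Rightarrow> vec \<Rightarrow> 'a filter \<Rightarrow> bool" where
  "l2_tendsto X L F \<longleftrightarrow> ((\<lambda>t. l2norm (\<lambda>w. X t w - L w)) \<longlongrightarrow> 0) F"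

definition l2_lim :: "nat \<Rightarrow> 'a filter \<Rightarrow> ('a \<Rightarrow> vec) \<Rightarrow> vec" where
  "l2_lim n F X = (THE L. L \<in> l2 n \<and> l2_tendsto X L F)"

definition taylor_coeff :: "(complex \<Rightarrow> complex) \<Rightarrow> nat \<Rightarrow> complex" where
  "taylor_coeff f k = (deriv ^^ k) f 0 / fact k"

text \<open>f(r S_1) = sum_k a_k r^k S_1^k (norm convergent for 0<=r<1), applied to psi.\<close>
definition fun_calc_r :: "nat \<Rightarrow> (complex \<Rightarrow> complex) \<Rightarrow> real \<Rightarrow> op" where
  "fun_calc_r n f r \<psi> = (if \<psi> \<in> l2 n then
      l2_lim n sequentially
        (\<lambda>N w. \<Sum>k<N. taylor_coeff f k * (complex_of_real r) ^ k * ((creation n 0 ^^ k) \<psi>) w)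
    else zero_vec)"

definition fun_calc :: "nat \<Rightarrow> (complex \<Rightarrow> complex) \<Rightarrow> op" where
  "fun_calc n f \<psi> = (if \<psi> \<in> l2 n then l2_lim n (at_left 1) (\<lambda>r. fun_calc_r n f r \<psi>)
                     else zero_vec)"

end

theory Submission
  imports Defs
begin

text \<open>
  If \<open>f(S\<^sub>1) = (1 - t) A + t B\<close> with contractions A and B, then
  \<open>\<parallel>f(S\<^sub>1) x\<parallel>\<^sup>2 + t(1 - t) \<parallel>(A - B) x\<parallel>\<^sup>2 \<le> \<parallel>x\<parallel>\<^sup>2\<close>. Elements of the algebra commute with the right creation
  operators, so \<open>A - B\<close> is determined by its value on the vacuum and acts on the vectors
  \<open>p(e\<^sub>1)\<close> as multiplication by a column of analytic functions. Testing on Szego kernels, which are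
  eigenvectors of the adjoint of a right creation operator, turns the inequality into
  \<open>|f|\<^sup>2 + t(1 - t) |g|\<^sup>2 \<le> 1\<close> on the disc for every entry g of that column. As \<open>2|f| \<le> 1 + |f|\<^sup>2\<close>, the
  functions \<open>f \<plusminus> t(1 - t) g\<^sup>2 / 2\<close> stay in the ball, so extremality of f forces \<open>g = 0\<close> and hence \<open>A = B\<close>.
  Conversely \<open>f \<mapsto> f(S\<^sub>1)\<close> is linear, injective and isometric: von Neumann's inequality for the shift is
  obtained from Parseval's identity on roots of unity, and the opposite bound from the kernels.
\<close>

section \<open>Von Neumann's inequality for the unilateral shift\<close>

lemma sum_roots_unity_orthogonal:
  fixes k m L :: nat
  assumes "k < L" "m < L"
  shows "(\<Sum>z | z ^ L = 1. z ^ k * cnj (z ^ m)) = (if k = m then of_nat L else (0::complex))"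
proof -
  let ?root = "\<lambda>j. cis (2 * pi * real j / real L)"
  define \<omega> where "\<omega> = ?root k * cnj (?root m)"
  have L: "L > 0" using assms by simp
  have "(\<Sum>z | z ^ L = 1. z ^ k * cnj (z ^ m)) = (\<Sum>j<L. ?root j ^ k * cnj (?root j ^ m))"
    by (rule sum.reindex_bij_betw[OF Complex.bij_betw_roots_unity[OF L], symmetric])
  also have "\<dots> = (\<Sum>j<L. \<omega> ^ j)"
    by (intro sum.cong refl)
      (simp only: \<omega>_def complex_cnj_power power_mult_distrib cis_cnj Complex.DeMoivre,
        simp add: mult_ac)
  also have "\<dots> = (if k = m then of_nat L else 0)"
  proof (cases "k = m")
    case True
    then have "\<omega> = 1" by (simp add: \<omega>_def cis_cnj cis_mult)
    with True show ?thesis by simp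
  next
    case False
    have quotient: "\<omega> = ?root k / ?root m" by (simp add: \<omega>_def cis_cnj cis_divide cis_mult)
    have "?root k \<noteq> ?root m"
      using Complex.bij_betw_roots_unity[OF L] assms False by (auto simp: bij_betw_def inj_on_def)
    then have "\<omega> \<noteq> 1" by (simp add: quotient)
    moreover have "\<omega> ^ L = 1"
      using L by (simp add: quotient power_divide Complex.DeMoivre cis_multiple_2pi)
    ultimately show ?thesis using False by (simp add: sum_gp_strict)
  qed
  finally show ?thesis .
qed

lemma poly_parseval_roots_unity:
  fixes p :: "complex poly"
  assumes "degree p < L"
  shows "(\<Sum>z | z ^ L = 1. (cmod (poly p z))\<^sup>2) = L * (\<Sum>m<L. (cmod (coeff p m))\<^sup>2)"
proof -
  let ?c = "coeff p"
  have poly_eq: "poly p z = (\<Sum>m<L. ?c m * z ^ m)" for z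
    unfolding poly_altdef by (rule sum.mono_neutral_left) (use assms in \<open>auto simp: coeff_eq_0\<close>)
  have "complex_of_real (\<Sum>z | z ^ L = 1. (cmod (poly p z))\<^sup>2)
      = (\<Sum>z | z ^ L = 1. \<Sum>k<L. \<Sum>m<L. ?c k * cnj (?c m) * (z ^ k * cnj (z ^ m)))"
    by (simp only: poly_eq of_real_sum complex_norm_square cnj_sum sum_product complex_cnj_mult
        mult_ac)
  also have "\<dots> = (\<Sum>k<L. \<Sum>m<L. \<Sum>z | z ^ L = 1. ?c k * cnj (?c m) * (z ^ k * cnj (z ^ m)))"
    by (subst sum.swap) (intro sum.cong refl sum.swap)
  also have "\<dots> = (\<Sum>k<L. \<Sum>m<L. ?c k * cnj (?c m) * (if k = m then of_nat L else 0))"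
    by (intro sum.cong refl)
      (simp add: sum_roots_unity_orthogonal flip: sum_distrib_left del: complex_cnj_power)
  also have "\<dots> = complex_of_real (L * (\<Sum>m<L. (cmod (?c m))\<^sup>2))"
    by (simp add: complex_norm_square sum_distrib_left mult_ac if_distrib del: of_real_power
        cong: if_cong)
  finally show ?thesis by (simp only: of_real_eq_iff)
qed

lemma sum_power2_coeff_mult_le:
  fixes p q :: "complex poly"
  assumes bound: "\<And>z. cmod z = 1 \<Longrightarrow> cmod (poly p z) \<le> M" and q: "degree q < N"
  shows "(\<Sum>m<N. (cmod (coeff (p * q) m))\<^sup>2) \<le> M\<^sup>2 * (\<Sum>m<N. (cmod (coeff q m))\<^sup>2)"
proof -
  \<comment> \<open>\<open>L\<close> exceeds the degree of \<open>p * q\<close>, so Parseval's identity is exact.\<close>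
  define L where "L = N + degree p"
  have L: "N \<le> L" "degree q < L" "degree (p * q) < L" "L > 0"
    using q degree_mult_le[of p q] by (auto simp: L_def)
  have unit: "cmod z = 1" if "z ^ L = 1" for z
    using arg_cong[OF that, of cmod] L(4) power_eq_iff_eq_base[of L "cmod z" 1]
    by (simp add: norm_power)
  have "L * (\<Sum>m<L. (cmod (coeff (p * q) m))\<^sup>2)
      = (\<Sum>z | z ^ L = 1. (cmod (poly p z))\<^sup>2 * (cmod (poly q z))\<^sup>2)"
    using poly_parseval_roots_unity[OF L(3)] by (simp add: norm_mult power_mult_distrib)
  also have "\<dots> \<le> (\<Sum>z | z ^ L = 1. M\<^sup>2 * (cmod (poly q z))\<^sup>2)"
    by (intro sum_mono mult_right_mono power_mono bound) (auto intro: unit)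
  also have "\<dots> = L * (M\<^sup>2 * (\<Sum>m<L. (cmod (coeff q m))\<^sup>2))"
    using poly_parseval_roots_unity[OF L(2)] by (simp flip: sum_distrib_left)
  also have "(\<Sum>m<L. (cmod (coeff q m))\<^sup>2) = (\<Sum>m<N. (cmod (coeff q m))\<^sup>2)"
    by (rule sum.mono_neutral_right) (use L q in \<open>auto simp: coeff_eq_0\<close>)
  finally have "(\<Sum>m<L. (cmod (coeff (p * q) m))\<^sup>2) \<le> M\<^sup>2 * (\<Sum>m<N. (cmod (coeff q m))\<^sup>2)"
    using L(4) by simp
  moreover have "(\<Sum>m<N. (cmod (coeff (p * q) m))\<^sup>2) \<le> (\<Sum>m<L. (cmod (coeff (p * q) m))\<^sup>2)"
    by (rule sum_mono2) (use L in auto)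
  ultimately show ?thesis by linarith
qed

lemma norm_partial_sum_le:
  fixes z :: "'a::{real_normed_field, banach}"
  assumes b: "summable (\<lambda>k. norm (b k))" and z: "norm z = 1"
  shows "norm (\<Sum>k<d. b k * z ^ k) \<le> norm (\<Sum>k. b k * z ^ k) + (\<Sum>k. norm (b (k + d)))"
proof -
  have norm_term: "norm (b k * z ^ k) = norm (b k)" for k using z by (simp add: norm_mult norm_power)
  have "summable (\<lambda>k. b k * z ^ k)" by (rule summable_norm_cancel) (simp add: norm_term b)
  then have "(\<Sum>k<d. b k * z ^ k) = (\<Sum>k. b k * z ^ k) - (\<Sum>k. b (k + d) * z ^ (k + d))"
    by (subst suminf_minus_initial_segment) auto
  also have "norm \<dots> \<le> norm (\<Sum>k. b k * z ^ k) + norm (\<Sum>k. b (k + d) * z ^ (k + d))"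
    by (rule norm_triangle_ineq4)
  also have "norm (\<Sum>k. b (k + d) * z ^ (k + d)) \<le> (\<Sum>k. norm (b (k + d)))"
    using summable_norm[of "\<lambda>k. b (k + d) * z ^ (k + d)"] b
    by (simp add: norm_term summable_iff_shift[of "\<lambda>k. norm (b k)"])
  finally show ?thesis by simp
qed

lemma toeplitz_bound_abs_summable:
  fixes b x :: "nat \<Rightarrow> complex"
  assumes summable: "summable (\<lambda>k. cmod (b k))"
    and bound: "\<And>z. cmod z = 1 \<Longrightarrow> cmod (\<Sum>k. b k * z ^ k) \<le> M"
  shows "(\<Sum>m<N. (cmod (\<Sum>k\<le>m. b k * x (m - k)))\<^sup>2) \<le> M\<^sup>2 * (\<Sum>m<N. (cmod (x m))\<^sup>2)"
    (is "?lhs \<le> _ * ?rhs")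
proof (cases "N = 0")
  case False
  define tail where "tail d = (\<Sum>k. cmod (b (k + d)))" for d
  have truncated: "?lhs \<le> (M + tail d)\<^sup>2 * ?rhs" if "N \<le> d" for d
  proof -
    define p where "p = (\<Sum>k<d. monom (b k) k)"
    define q where "q = (\<Sum>m<N. monom (x m) m)"
    have coeffs: "coeff p k = (if k < d then b k else 0)"
      "coeff q m = (if m < N then x m else 0)" for k m
      by (auto simp: p_def q_def coeff_sum)
    have "degree q < N"
      unfolding q_def using False by (auto intro!: degree_sum_less le_less_trans[OF degree_monom_le])
    moreover have "cmod (poly p z) \<le> M + tail d" if z: "cmod z = 1" for z
      using norm_partial_sum_le[OF summable z, of d] bound[OF z]
      by (simp add: p_def tail_def poly_sum poly_monom)
    ultimately have "(\<Sum>m<N. (cmod (coeff (p * q) m))\<^sup>2)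
        \<le> (M + tail d)\<^sup>2 * (\<Sum>m<N. (cmod (coeff q m))\<^sup>2)"
      by (intro sum_power2_coeff_mult_le)
    moreover have "coeff (p * q) m = (\<Sum>k\<le>m. b k * x (m - k))" if "m < N" for m
      unfolding coeff_mult coeffs using that \<open>N \<le> d\<close> by (intro sum.cong) auto
    ultimately show ?thesis by (simp add: coeffs)
  qed
  have "(\<lambda>d. (M + tail d)\<^sup>2 * ?rhs) \<longlonglongrightarrow> (M + 0)\<^sup>2 * ?rhs"
    unfolding tail_def by (intro tendsto_intros suminf_exist_split2[OF summable])
  then have "?lhs \<le> (M + 0)\<^sup>2 * ?rhs" by (rule LIMSEQ_le_const) (use truncated in blast)
  then show ?thesis by simp
qed simp

definition disc_bounded :: "(nat \<Rightarrow> complex) \<Rightarrow> real \<Rightarrow> bool" where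
  "disc_bounded b M \<longleftrightarrow>
    (\<forall>z. cmod z < 1 \<longrightarrow> summable (\<lambda>k. b k * z ^ k) \<and> cmod (\<Sum>k. b k * z ^ k) \<le> M)"

lemma disc_bounded_nonneg: "disc_bounded b M \<Longrightarrow> 0 \<le> M"
  unfolding disc_bounded_def by (metis norm_ge_zero norm_zero order_trans zero_less_one)

lemma disc_bounded_abs_summable:
  assumes "summable (\<lambda>k. cmod (b k))"
  shows "disc_bounded b (\<Sum>k. cmod (b k))"
  unfolding disc_bounded_def
proof (intro allI impI)
  fix z :: complex assume "cmod z < 1"
  then have le: "cmod (b k * z ^ k) \<le> cmod (b k)" for k
    by (simp add: norm_mult norm_power mult_left_le power_le_one)
  have abs: "summable (\<lambda>k. cmod (b k * z ^ k))"
    by (rule summable_comparison_test'[OF assms]) (simp add: le)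
  then show "summable (\<lambda>k. b k * z ^ k) \<and> cmod (\<Sum>k. b k * z ^ k) \<le> (\<Sum>k. cmod (b k))"
    using summable_norm[OF abs] suminf_le[OF le abs assms] summable_norm_cancel[OF abs] by linarith
qed

abbreviation dilate_coeffs :: "real \<Rightarrow> (nat \<Rightarrow> complex) \<Rightarrow> nat \<Rightarrow> complex" where
  "dilate_coeffs r b \<equiv> (\<lambda>k. b k * complex_of_real r ^ k)"

lemma disc_bounded_dilate:
  assumes "disc_bounded b M" "0 \<le> r" "r \<le> 1"
  shows "disc_bounded (dilate_coeffs r b) M"
proof -
  have "cmod (complex_of_real r * z) < 1" if "cmod z < 1" for z
    using mult_left_le_one_le[of "cmod z" r] that assms by (simp add: norm_mult)
  then have "summable (\<lambda>k. b k * (complex_of_real r * z) ^ k) \<and>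
      cmod (\<Sum>k. b k * (complex_of_real r * z) ^ k) \<le> M" if "cmod z < 1" for z
    using that assms(1) unfolding disc_bounded_def by blast
  then show ?thesis by (simp add: disc_bounded_def power_mult_distrib mult.assoc)
qed

lemma disc_bounded_dilate_abs_summable:
  assumes "disc_bounded b M" "0 \<le> r" "r < 1"
  shows "summable (\<lambda>k. cmod (dilate_coeffs r b k))"
proof (rule powser_insidea)
  let ?s = "complex_of_real ((1 + r) / 2)"
  have s: "cmod ?s = (1 + r) / 2" using assms by (simp only: norm_of_real) simp
  show "summable (\<lambda>k. b k * ?s ^ k)" using assms s unfolding disc_bounded_def by simp
  show "cmod (complex_of_real r) < cmod ?s" unfolding s using assms by simp
qed

lemma toeplitz_bound_disc_bounded:
  fixes b x :: "nat \<Rightarrow> complex"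
  assumes b: "disc_bounded b M"
  shows "(\<Sum>m<N. (cmod (\<Sum>k\<le>m. b k * x (m - k)))\<^sup>2) \<le> M\<^sup>2 * (\<Sum>m<N. (cmod (x m))\<^sup>2)"
proof -
  let ?T = "\<lambda>r. \<Sum>m<N. (cmod (\<Sum>k\<le>m. b k * complex_of_real r ^ k * x (m - k)))\<^sup>2"
  have dilated: "?T r \<le> M\<^sup>2 * (\<Sum>m<N. (cmod (x m))\<^sup>2)" if r: "0 < r" "r < 1" for r
  proof (rule toeplitz_bound_abs_summable)
    show "summable (\<lambda>k. cmod (b k * complex_of_real r ^ k))"
      by (rule disc_bounded_dilate_abs_summable[OF b]) (use r in auto)
    show "cmod (\<Sum>k. b k * complex_of_real r ^ k * z ^ k) \<le> M" if "cmod z = 1" for z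
    proof -
      have "cmod (complex_of_real r * z) < 1" using r that by (simp add: norm_mult)
      then have "cmod (\<Sum>k. b k * (complex_of_real r * z) ^ k) \<le> M"
        using b unfolding disc_bounded_def by blast
      then show ?thesis by (simp add: power_mult_distrib mult.assoc)
    qed
  qed
  have "(?T \<longlongrightarrow> ?T 1) (at_left 1)" by (intro tendsto_intros)
  moreover have "\<forall>\<^sub>F r in at_left 1. ?T r \<le> M\<^sup>2 * (\<Sum>m<N. (cmod (x m))\<^sup>2)"
    by (rule eventually_at_leftI[of 0]) (auto intro: dilated)
  ultimately have "?T 1 \<le> M\<^sup>2 * (\<Sum>m<N. (cmod (x m))\<^sup>2)" by (rule tendsto_upperbound) simp
  then show ?thesis by simp
qed

section \<open>Square-summable vectors\<close>

lemma words_simps [simp]: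
  "[] \<in> words n"
  "i # w \<in> words n \<longleftrightarrow> i < n \<and> w \<in> words n"
  "u @ v \<in> words n \<longleftrightarrow> u \<in> words n \<and> v \<in> words n"
  "replicate m i \<in> words n \<longleftrightarrow> m = 0 \<or> i < n"
  by (auto simp: words_def)

lemma l2norm_nonneg: "0 \<le> l2norm \<psi>"
  unfolding l2norm_def by (intro real_sqrt_ge_zero infsum_nonneg) auto

lemma l2norm_power2: "(l2norm \<psi>)\<^sup>2 = (\<Sum>\<^sub>\<infinity>w. (cmod (\<psi> w))\<^sup>2)"
  unfolding l2norm_def by (intro real_sqrt_pow2 infsum_nonneg) auto

lemma l2_summable: "\<psi> \<in> l2 n \<Longrightarrow> (\<lambda>w. (cmod (\<psi> w))\<^sup>2) summable_on UNIV"
  by (simp add: l2_def)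

lemma l2_vanishes: "\<psi> \<in> l2 n \<Longrightarrow> w \<notin> words n \<Longrightarrow> \<psi> w = 0"
  by (simp add: l2_def)

lemma sum_power2_le_l2norm_power2:
  assumes "\<psi> \<in> l2 n" "finite F"
  shows "(\<Sum>w\<in>F. (cmod (\<psi> w))\<^sup>2) \<le> (l2norm \<psi>)\<^sup>2"
  unfolding l2norm_power2 using assms l2_summable by (intro finite_sum_le_infsum) auto

lemma L2_set_le_l2norm:
  assumes "\<psi> \<in> l2 n" "finite F"
  shows "L2_set (\<lambda>w. cmod (\<psi> w)) F \<le> l2norm \<psi>"
  unfolding L2_set_def by (rule real_le_lsqrt[OF l2norm_nonneg sum_power2_le_l2norm_power2[OF assms]])

lemma l2I_L2_set_bounded:
  assumes vanishes: "\<And>w. w \<notin> words n \<Longrightarrow> \<psi> w = 0"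
    and bound: "\<And>F. finite F \<Longrightarrow> L2_set (\<lambda>w. cmod (\<psi> w)) F \<le> C"
  shows "\<psi> \<in> l2 n" "l2norm \<psi> \<le> C"
proof -
  have C: "0 \<le> C" using bound[of "{}"] by simp
  have sum_le: "(\<Sum>w\<in>F. (cmod (\<psi> w))\<^sup>2) \<le> C\<^sup>2" if "finite F" for F
    using bound[OF that] C by (simp add: L2_set_def real_sqrt_le_iff' sum_nonneg)
  have summable: "(\<lambda>w. (cmod (\<psi> w))\<^sup>2) summable_on UNIV"
    by (rule nonneg_bdd_above_summable_on) (auto intro!: bdd_aboveI[of _ "C\<^sup>2"] sum_le)
  then show "\<psi> \<in> l2 n" using vanishes by (simp add: l2_def)
  have "(l2norm \<psi>)\<^sup>2 \<le> C\<^sup>2"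
    unfolding l2norm_power2 by (rule infsum_le_finite_sums[OF summable]) (use sum_le in auto)
  then show "l2norm \<psi> \<le> C" using C by (rule power2_le_imp_le)
qed

lemma l2_dominated:
  assumes \<phi>: "\<phi> \<in> l2 n" and le: "\<And>w. cmod (\<psi> w) \<le> K * cmod (\<phi> w)" and K: "0 \<le> K"
  shows "\<psi> \<in> l2 n" "l2norm \<psi> \<le> K * l2norm \<phi>"
proof -
  have vanishes: "\<psi> w = 0" if "w \<notin> words n" for w
    using le[of w] l2_vanishes[OF \<phi> that] by simp
  have bound: "L2_set (\<lambda>w. cmod (\<psi> w)) F \<le> K * l2norm \<phi>" if "finite F" for F
  proof -
    have "L2_set (\<lambda>w. cmod (\<psi> w)) F \<le> K * L2_set (\<lambda>w. cmod (\<phi> w)) F"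
      unfolding L2_set_right_distrib[OF K] by (intro L2_set_mono le) auto
    also have "\<dots> \<le> K * l2norm \<phi>" by (intro mult_left_mono L2_set_le_l2norm[OF \<phi> that] K)
    finally show ?thesis .
  qed
  show "\<psi> \<in> l2 n" "l2norm \<psi> \<le> K * l2norm \<phi>"
    by (rule l2I_L2_set_bounded[OF vanishes bound]; assumption)+
qed

lemma l2_add:
  assumes \<psi>: "\<psi> \<in> l2 n" and \<phi>: "\<phi> \<in> l2 n"
  shows "(\<lambda>w. \<psi> w + \<phi> w) \<in> l2 n"
    and l2norm_triangle_ineq: "l2norm (\<lambda>w. \<psi> w + \<phi> w) \<le> l2norm \<psi> + l2norm \<phi>"
proof -
  have bound: "L2_set (\<lambda>w. cmod (\<psi> w + \<phi> w)) F \<le> l2norm \<psi> + l2norm \<phi>" if "finite F" for F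
  proof -
    have "L2_set (\<lambda>w. cmod (\<psi> w + \<phi> w)) F \<le> L2_set (\<lambda>w. cmod (\<psi> w) + cmod (\<phi> w)) F"
      by (intro L2_set_mono norm_triangle_ineq) auto
    also have "\<dots> \<le> L2_set (\<lambda>w. cmod (\<psi> w)) F + L2_set (\<lambda>w. cmod (\<phi> w)) F"
      by (rule L2_set_triangle_ineq)
    also have "\<dots> \<le> l2norm \<psi> + l2norm \<phi>"
      by (intro add_mono L2_set_le_l2norm[OF \<psi> that] L2_set_le_l2norm[OF \<phi> that])
    finally show ?thesis .
  qed
  show "(\<lambda>w. \<psi> w + \<phi> w) \<in> l2 n" "l2norm (\<lambda>w. \<psi> w + \<phi> w) \<le> l2norm \<psi> + l2norm \<phi>"
    by (rule l2I_L2_set_bounded[where n=n, OF _ bound]; use \<psi> \<phi> in \<open>simp add: l2_vanishes\<close>)+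
qed

lemma l2_restrict: "\<psi> \<in> l2 n \<Longrightarrow> (\<lambda>w. of_bool (P w) * \<psi> w) \<in> l2 n"
  by (rule l2_dominated(1)[of \<psi> n _ 1]) auto

lemma l2_cmult: "\<psi> \<in> l2 n \<Longrightarrow> (\<lambda>w. a * \<psi> w) \<in> l2 n"
  by (rule l2_dominated(1)[where K="cmod a"]) (auto simp: norm_mult)

lemma l2norm_cmult: "l2norm (\<lambda>w. a * \<psi> w) = cmod a * l2norm \<psi>"
  by (simp add: l2norm_def norm_mult power_mult_distrib infsum_cmult_right' real_sqrt_mult)

lemma l2_lincomb: "\<psi> \<in> l2 n \<Longrightarrow> \<phi> \<in> l2 n \<Longrightarrow> (\<lambda>w. a * \<psi> w + b * \<phi> w) \<in> l2 n"
  by (intro l2_add l2_cmult)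

lemma l2_diff: "\<psi> \<in> l2 n \<Longrightarrow> \<phi> \<in> l2 n \<Longrightarrow> (\<lambda>w. \<psi> w - \<phi> w) \<in> l2 n"
  using l2_lincomb[of \<psi> n \<phi> 1 "-1"] by simp

lemma l2norm_diff_le:
  assumes "\<psi> \<in> l2 n" "\<phi> \<in> l2 n"
  shows "l2norm (\<lambda>w. \<psi> w - \<phi> w) \<le> l2norm \<psi> + l2norm \<phi>"
  using l2norm_triangle_ineq[OF assms(1) l2_cmult[OF assms(2), of "-1"]] l2norm_cmult[of "-1" \<phi>]
  by simp

lemma zero_vec_in_l2: "zero_vec \<in> l2 n"
  by (simp add: l2_def zero_vec_def)

lemma l2norm_zero_vec: "l2norm zero_vec = 0"
  by (simp add: l2norm_def zero_vec_def)

lemma l2norm_convex_power2: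
  assumes \<psi>: "\<psi> \<in> l2 n" and \<phi>: "\<phi> \<in> l2 n"
  shows "(l2norm (\<lambda>w. (1 - complex_of_real t) * \<psi> w + complex_of_real t * \<phi> w))\<^sup>2
      + t * (1 - t) * (l2norm (\<lambda>w. \<psi> w - \<phi> w))\<^sup>2
    = (1 - t) * (l2norm \<psi>)\<^sup>2 + t * (l2norm \<phi>)\<^sup>2"
    (is "(l2norm ?c)\<^sup>2 + _ * (l2norm ?d)\<^sup>2 = _")
proof -
  have pointwise: "(cmod (?c w))\<^sup>2 + t * (1 - t) * (cmod (?d w))\<^sup>2
      = (1 - t) * (cmod (\<psi> w))\<^sup>2 + t * (cmod (\<phi> w))\<^sup>2" for w
    unfolding cmod_power2 by (simp add: power2_eq_square algebra_simps)
  have "(l2norm ?c)\<^sup>2 + t * (1 - t) * (l2norm ?d)\<^sup>2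
      = (\<Sum>\<^sub>\<infinity>w. (cmod (?c w))\<^sup>2 + t * (1 - t) * (cmod (?d w))\<^sup>2)"
    unfolding l2norm_power2 infsum_cmult_right'[symmetric]
    by (intro infsum_add[symmetric] summable_on_cmult_right
        l2_summable[OF l2_lincomb[OF \<psi> \<phi>]] l2_summable[OF l2_diff[OF \<psi> \<phi>]])
  also have "\<dots> = (1 - t) * (l2norm \<psi>)\<^sup>2 + t * (l2norm \<phi>)\<^sup>2"
    unfolding pointwise l2norm_power2 infsum_cmult_right'[symmetric]
    by (intro infsum_add summable_on_cmult_right l2_summable[OF \<psi>] l2_summable[OF \<phi>])
  finally show ?thesis .
qed

lemma l2_reindex:
  assumes \<psi>: "\<psi> \<in> l2 n" and g: "inj g" "\<And>w. w \<in> words n \<Longrightarrow> g w \<in> words n"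
    and \<phi>: "\<And>w. \<phi> (g w) = \<psi> w" "\<And>w. w \<notin> range g \<Longrightarrow> \<phi> w = 0"
  shows "\<phi> \<in> l2 n"
proof -
  have "((\<lambda>w. (cmod (\<phi> w))\<^sup>2) \<circ> g) summable_on UNIV"
    using l2_summable[OF \<psi>] by (simp add: o_def \<phi>(1))
  then have "(\<lambda>w. (cmod (\<phi> w))\<^sup>2) summable_on range g"
    using g(1) by (simp add: summable_on_reindex)
  then have "(\<lambda>w. (cmod (\<phi> w))\<^sup>2) summable_on UNIV"
    by (rule summable_on_cong_neutral[THEN iffD1, rotated 3]) (auto simp: \<phi>(2))
  moreover have "\<phi> w = 0" if "w \<notin> words n" for w
    using that g(2) \<phi> l2_vanishes[OF \<psi>] by (metis rangeE)
  ultimately show ?thesis by (simp add: l2_def)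
qed

definition basis_vec :: "nat list \<Rightarrow> vec" where
  "basis_vec u w = of_bool (w = u)"

lemma basis_vec_in_l2: "u \<in> words n \<Longrightarrow> basis_vec u \<in> l2 n"
  by (auto simp: l2_def basis_vec_def
      intro: summable_on_cong_neutral[THEN iffD1, OF _ _ _ summable_on_finite[of "{u}"]])

abbreviation vacuum :: vec where
  "vacuum \<equiv> basis_vec []"

lemma vacuum_in_l2: "vacuum \<in> l2 n"
  by (simp add: basis_vec_in_l2)

lemma l2inner_basis_vec: "l2inner \<psi> (basis_vec u) = \<psi> u"
proof -
  have "l2inner \<psi> (basis_vec u) = (\<Sum>\<^sub>\<infinity>w\<in>{u}. \<psi> w)"
    unfolding l2inner_def by (rule infsum_cong_neutral) (auto simp: basis_vec_def)
  then show ?thesis by simp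
qed

lemma l2inner_cauchy_schwarz:
  assumes \<psi>: "\<psi> \<in> l2 n" and \<phi>: "\<phi> \<in> l2 n"
  shows l2inner_summable: "(\<lambda>w. \<psi> w * cnj (\<phi> w)) summable_on UNIV"
    and cmod_l2inner_le: "cmod (l2inner \<psi> \<phi>) \<le> l2norm \<psi> * l2norm \<phi>"
proof -
  have bound: "(\<Sum>w\<in>F. cmod (\<psi> w * cnj (\<phi> w))) \<le> l2norm \<psi> * l2norm \<phi>" if "finite F" for F
  proof -
    have "(\<Sum>w\<in>F. cmod (\<psi> w * cnj (\<phi> w))) \<le> L2_set (\<lambda>w. cmod (\<psi> w)) F * L2_set (\<lambda>w. cmod (\<phi> w)) F"
      using L2_set_mult_ineq[of "\<lambda>w. cmod (\<psi> w)" "\<lambda>w. cmod (\<phi> w)" F] by (simp add: norm_mult)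
    also have "\<dots> \<le> l2norm \<psi> * l2norm \<phi>"
      by (intro mult_mono L2_set_le_l2norm[OF \<psi> that] L2_set_le_l2norm[OF \<phi> that] l2norm_nonneg) auto
    finally show ?thesis .
  qed
  have abs: "(\<lambda>w. cmod (\<psi> w * cnj (\<phi> w))) summable_on UNIV"
    by (rule nonneg_bdd_above_summable_on) (auto intro!: bdd_aboveI bound)
  then show "(\<lambda>w. \<psi> w * cnj (\<phi> w)) summable_on UNIV" by (rule abs_summable_summable)
  have "cmod (l2inner \<psi> \<phi>) \<le> (\<Sum>\<^sub>\<infinity>w. cmod (\<psi> w * cnj (\<phi> w)))"
    unfolding l2inner_def by (rule norm_infsum_bound[OF abs])
  also have "\<dots> \<le> l2norm \<psi> * l2norm \<phi>" by (rule infsum_le_finite_sums[OF abs]) (use bound in auto)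
  finally show "cmod (l2inner \<psi> \<phi>) \<le> l2norm \<psi> * l2norm \<phi>" .
qed

lemma l2inner_lincomb_left:
  assumes "\<psi> \<in> l2 n" "\<phi> \<in> l2 n" "\<xi> \<in> l2 n"
  shows "l2inner (\<lambda>w. a * \<psi> w + b * \<phi> w) \<xi> = a * l2inner \<psi> \<xi> + b * l2inner \<phi> \<xi>"
  unfolding l2inner_def infsum_cmult_right'[symmetric] distrib_right mult.assoc
  by (intro infsum_add summable_on_cmult_right l2inner_summable[OF assms(1,3)]
      l2inner_summable[OF assms(2,3)])

lemma l2inner_diff_left:
  assumes "\<psi> \<in> l2 n" "\<phi> \<in> l2 n" "\<xi> \<in> l2 n"
  shows "l2inner (\<lambda>w. \<psi> w - \<phi> w) \<xi> = l2inner \<psi> \<xi> - l2inner \<phi> \<xi>"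
  using l2inner_lincomb_left[OF assms, of 1 "-1"] by simp

lemma l2_tendstoI:
  assumes "\<forall>\<^sub>F t in F. l2norm (\<lambda>w. X t w - L w) \<le> g t" "(g \<longlongrightarrow> 0) F"
  shows "l2_tendsto X L F"
  unfolding l2_tendsto_def by (rule Lim_null_comparison) (use assms in \<open>simp_all add: l2norm_nonneg\<close>)

lemma l2_tendsto_l2inner:
  assumes lim: "l2_tendsto X L F" and X: "\<forall>\<^sub>F t in F. X t \<in> l2 n" and "L \<in> l2 n" "\<phi> \<in> l2 n"
  shows "((\<lambda>t. l2inner (X t) \<phi>) \<longlongrightarrow> l2inner L \<phi>) F"
proof (rule Lim_transform_bound[THEN LIM_zero_cancel])
  show "((\<lambda>t. l2norm (\<lambda>w. X t w - L w) * l2norm \<phi>) \<longlongrightarrow> 0) F"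
    using lim unfolding l2_tendsto_def by (rule tendsto_mult_left_zero)
  show "\<forall>\<^sub>F t in F. norm (l2inner (X t) \<phi> - l2inner L \<phi>) \<le> norm (l2norm (\<lambda>w. X t w - L w) * l2norm \<phi>)"
    using X
  proof eventually_elim
    case (elim t)
    then show ?case
      using cmod_l2inner_le[OF l2_diff[OF elim assms(3)] assms(4)]
      by (simp add: l2inner_diff_left[OF elim assms(3,4)] l2norm_nonneg)
  qed
qed

lemma l2_tendsto_unique:
  assumes "F \<noteq> bot" "\<forall>\<^sub>F t in F. X t \<in> l2 n"
    and L: "L \<in> l2 n" "l2_tendsto X L F" and L': "L' \<in> l2 n" "l2_tendsto X L' F"
  shows "L = L'"
proof
  fix w
  show "L w = L' w"
  proof (cases "w \<in> words n")
    case True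
    have "((\<lambda>t. X t w) \<longlongrightarrow> K w) F" if "K \<in> l2 n" "l2_tendsto X K F" for K
      using l2_tendsto_l2inner[OF that(2) assms(2) that(1) basis_vec_in_l2[OF True]]
      by (simp add: l2inner_basis_vec)
    then show ?thesis using tendsto_unique[OF assms(1)] L L' by blast
  qed (use L L' in \<open>simp add: l2_vanishes\<close>)
qed

lemma l2_lim_eqI:
  assumes "F \<noteq> bot" "\<forall>\<^sub>F t in F. X t \<in> l2 n" "L \<in> l2 n" "l2_tendsto X L F"
  shows "l2_lim n F X = L"
  unfolding l2_lim_def by (rule the_equality) (use assms l2_tendsto_unique in blast)+

lemma l2norm_off_finite_tendsto_0:
  assumes \<psi>: "\<psi> \<in> l2 n"
  shows "((\<lambda>G. l2norm (\<lambda>w. of_bool (w \<notin> G) * \<psi> w)) \<longlongrightarrow> 0) (finite_subsets_at_top UNIV)"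
proof -
  let ?f = "\<lambda>w. (cmod (\<psi> w))\<^sup>2"
  have off: "(l2norm (\<lambda>w. of_bool (w \<notin> G) * \<psi> w))\<^sup>2 = infsum ?f UNIV - sum ?f G" if "finite G" for G
  proof -
    have "(l2norm (\<lambda>w. of_bool (w \<notin> G) * \<psi> w))\<^sup>2 = infsum ?f (- G)"
      unfolding l2norm_power2 by (rule infsum_cong_neutral) auto
    also have "\<dots> = infsum ?f UNIV - infsum ?f G"
      unfolding Compl_eq_Diff_UNIV
      by (rule infsum_Diff) (use l2_summable[OF \<psi>] that in auto)
    finally show ?thesis using that by simp
  qed
  have "((\<lambda>G. infsum ?f UNIV - sum ?f G) \<longlongrightarrow> infsum ?f UNIV - infsum ?f UNIV)
      (finite_subsets_at_top UNIV)"
    by (intro tendsto_intros infsum_tendsto l2_summable[OF \<psi>])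
  then have "((\<lambda>G. (l2norm (\<lambda>w. of_bool (w \<notin> G) * \<psi> w))\<^sup>2) \<longlongrightarrow> 0) (finite_subsets_at_top UNIV)"
    by (rule Lim_transform_eventually[THEN tendsto_eq_rhs])
      (auto simp: off intro: eventually_finite_subsets_at_top_weakI)
  from tendsto_real_sqrt[OF this] show ?thesis by (simp add: l2norm_nonneg)
qed

lemma l2norm_le_sum_plus_off_finite:
  assumes \<psi>: "\<psi> \<in> l2 n" and G: "finite G"
  shows "l2norm \<psi> \<le> (\<Sum>w\<in>G. cmod (\<psi> w)) + l2norm (\<lambda>w. of_bool (w \<notin> G) * \<psi> w)"
proof (rule l2I_L2_set_bounded(2)[where n=n])
  let ?off = "\<lambda>w. of_bool (w \<notin> G) * \<psi> w"
  have off: "?off \<in> l2 n" by (rule l2_restrict[OF \<psi>])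
  fix H :: "nat list set" assume H: "finite H"
  have "L2_set (\<lambda>w. cmod (\<psi> w)) H = L2_set (\<lambda>w. of_bool (w \<in> G) * cmod (\<psi> w) + cmod (?off w)) H"
    by (rule L2_set_cong) auto
  also have "\<dots> \<le> L2_set (\<lambda>w. of_bool (w \<in> G) * cmod (\<psi> w)) H + L2_set (\<lambda>w. cmod (?off w)) H"
    by (rule L2_set_triangle_ineq)
  also have "\<dots> \<le> (\<Sum>w\<in>G. cmod (\<psi> w)) + l2norm ?off"
  proof (rule add_mono[OF _ L2_set_le_l2norm[OF off H]])
    have "L2_set (\<lambda>w. of_bool (w \<in> G) * cmod (\<psi> w)) H \<le> (\<Sum>w\<in>H. of_bool (w \<in> G) * cmod (\<psi> w))"
      by (rule L2_set_le_sum) simp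
    also have "\<dots> = (\<Sum>w\<in>H \<inter> G. cmod (\<psi> w))"
      by (rule sum.mono_neutral_cong_right) (use H in auto)
    also have "\<dots> \<le> (\<Sum>w\<in>G. cmod (\<psi> w))" by (rule sum_mono2) (use G in auto)
    finally show "L2_set (\<lambda>w. of_bool (w \<in> G) * cmod (\<psi> w)) H \<le> (\<Sum>w\<in>G. cmod (\<psi> w))" .
  qed
  finally show "L2_set (\<lambda>w. cmod (\<psi> w)) H \<le> (\<Sum>w\<in>G. cmod (\<psi> w)) + l2norm ?off" .
qed (rule l2_vanishes[OF \<psi>])

lemma l2norm_multiplier_tendsto_0:
  assumes \<psi>: "\<psi> \<in> l2 n" and bounded: "\<forall>\<^sub>F t in F. \<forall>w. cmod (c t w) \<le> K" and K: "0 \<le> K"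
    and lim: "\<And>w. ((\<lambda>t. c t w) \<longlongrightarrow> 0) F"
  shows "((\<lambda>t. l2norm (\<lambda>w. c t w * \<psi> w)) \<longlongrightarrow> 0) F"
proof (rule tendstoI)
  fix e :: real assume e: "e > 0"
  let ?off = "\<lambda>G w. of_bool (w \<notin> G) * \<psi> w"
  have "((\<lambda>G. K * l2norm (?off G)) \<longlongrightarrow> 0) (finite_subsets_at_top UNIV)"
    by (rule tendsto_mult_right_zero[OF l2norm_off_finite_tendsto_0[OF \<psi>]])
  then have "\<forall>\<^sub>F G in finite_subsets_at_top UNIV. finite G \<and> K * l2norm (?off G) < e / 2"
    using e order_tendstoD(2)[of _ 0 "finite_subsets_at_top UNIV" "e / 2"]
    by (intro eventually_conj) (auto intro: eventually_finite_subsets_at_top_weakI)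
  then obtain G where G: "finite G" and off_G: "K * l2norm (?off G) < e / 2"
    using eventually_happens'[OF finite_subsets_at_top_neq_bot] by blast
  have "((\<lambda>t. \<Sum>w\<in>G. cmod (c t w * \<psi> w)) \<longlongrightarrow> (\<Sum>w\<in>G. cmod (0 * \<psi> w))) F"
    by (intro tendsto_intros lim)
  then have "\<forall>\<^sub>F t in F. (\<Sum>w\<in>G. cmod (c t w * \<psi> w)) < e / 2"
    using e order_tendstoD(2)[of _ 0 F "e / 2"] by simp
  with bounded show "\<forall>\<^sub>F t in F. dist (l2norm (\<lambda>w. c t w * \<psi> w)) 0 < e"
  proof eventually_elim
    case (elim t)
    have le: "cmod (c t w * \<psi> w) \<le> K * cmod (\<psi> w)" for w
      using elim(1) by (simp add: norm_mult mult_right_mono)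
    have off: "?off G \<in> l2 n" by (rule l2_restrict[OF \<psi>])
    have "l2norm (\<lambda>w. c t w * \<psi> w)
        \<le> (\<Sum>w\<in>G. cmod (c t w * \<psi> w)) + l2norm (\<lambda>w. of_bool (w \<notin> G) * (c t w * \<psi> w))"
      by (rule l2norm_le_sum_plus_off_finite[OF l2_dominated(1)[OF \<psi> le K] G])
    also have "l2norm (\<lambda>w. of_bool (w \<notin> G) * (c t w * \<psi> w)) \<le> K * l2norm (?off G)"
      by (rule l2_dominated(2)[OF off _ K]) (use le in simp)
    finally show ?case using elim(2) off_G by (simp add: l2norm_nonneg)
  qed
qed

section \<open>Bounded operators and weak operator closures\<close>

lemma bounded_op_in_l2: "bounded_op n T \<Longrightarrow> \<psi> \<in> l2 n \<Longrightarrow> T \<psi> \<in> l2 n"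
  by (simp add: bounded_op_def)

lemma bounded_op_lincomb:
  "bounded_op n T \<Longrightarrow> \<psi> \<in> l2 n \<Longrightarrow> \<phi> \<in> l2 n \<Longrightarrow> T (\<lambda>w. a * \<psi> w + b * \<phi> w) = (\<lambda>w. a * T \<psi> w + b * T \<phi> w)"
  by (simp add: bounded_op_def)

lemma bounded_op_cmult: "bounded_op n T \<Longrightarrow> \<psi> \<in> l2 n \<Longrightarrow> T (\<lambda>w. a * \<psi> w) = (\<lambda>w. a * T \<psi> w)"
  using bounded_op_lincomb[of n T \<psi> \<psi> a 0] by simp

lemma bounded_op_diff:
  "bounded_op n T \<Longrightarrow> \<psi> \<in> l2 n \<Longrightarrow> \<phi> \<in> l2 n \<Longrightarrow> T (\<lambda>w. \<psi> w - \<phi> w) = (\<lambda>w. T \<psi> w - T \<phi> w)"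
  using bounded_op_lincomb[of n T \<psi> \<phi> 1 "-1"] by simp

lemma bounded_op_outside: "bounded_op n T \<Longrightarrow> \<psi> \<notin> l2 n \<Longrightarrow> T \<psi> = zero_vec"
  by (simp add: bounded_op_def)

lemma bounded_op_boundE:
  assumes "bounded_op n T"
  obtains C where "0 \<le> C" "\<And>\<psi>. \<psi> \<in> l2 n \<Longrightarrow> l2norm (T \<psi>) \<le> C * l2norm \<psi>"
proof -
  obtain C where C: "\<forall>\<psi>\<in>l2 n. l2norm (T \<psi>) \<le> C * l2norm \<psi>" using assms by (auto simp: bounded_op_def)
  have "l2norm (T \<psi>) \<le> \<bar>C\<bar> * l2norm \<psi>" if "\<psi> \<in> l2 n" for \<psi>
    using bspec[OF C that] mult_right_mono[OF abs_ge_self[of C] l2norm_nonneg[of \<psi>]] by linarith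
  then show ?thesis using that[of "\<bar>C\<bar>"] by simp
qed

lemma bounded_op_l2_tendsto:
  assumes T: "bounded_op n T" and X: "\<forall>\<^sub>F t in F. X t \<in> l2 n" and L: "L \<in> l2 n" "l2_tendsto X L F"
  shows "l2_tendsto (\<lambda>t. T (X t)) (T L) F"
proof -
  obtain C where C: "\<And>\<psi>. \<psi> \<in> l2 n \<Longrightarrow> l2norm (T \<psi>) \<le> C * l2norm \<psi>"
    using T by (rule bounded_op_boundE) blast
  show ?thesis
  proof (rule l2_tendstoI)
    show "((\<lambda>t. C * l2norm (\<lambda>w. X t w - L w)) \<longlongrightarrow> 0) F"
      using L(2) unfolding l2_tendsto_def by (rule tendsto_mult_right_zero)
    show "\<forall>\<^sub>F t in F. l2norm (\<lambda>w. T (X t) w - T L w) \<le> C * l2norm (\<lambda>w. X t w - L w)"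
      using X
    proof eventually_elim
      case (elim t)
      then show ?case using C[OF l2_diff[OF elim L(1)]] bounded_op_diff[OF T elim L(1)] by simp
    qed
  qed
qed

lemma l2_tendsto_finite_truncation:
  assumes "\<psi> \<in> l2 n"
  shows "l2_tendsto (\<lambda>G w. of_bool (w \<in> G) * \<psi> w) \<psi> (finite_subsets_at_top UNIV)"
proof -
  have "(\<lambda>w. of_bool (w \<in> G) * \<psi> w - \<psi> w) = (\<lambda>w. - 1 * (of_bool (w \<notin> G) * \<psi> w))" for G
    by (auto simp: fun_eq_iff)
  then have "l2norm (\<lambda>w. of_bool (w \<in> G) * \<psi> w - \<psi> w) = l2norm (\<lambda>w. of_bool (w \<notin> G) * \<psi> w)" for G
    by (simp only: l2norm_cmult) simp
  then show ?thesis unfolding l2_tendsto_def using l2norm_off_finite_tendsto_0[OF assms] by simp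
qed

lemma bounded_op_eq_on_finite_truncation:
  assumes A: "bounded_op n A" and B: "bounded_op n B"
    and eq: "\<And>u. u \<in> words n \<Longrightarrow> A (basis_vec u) = B (basis_vec u)"
    and \<psi>: "\<psi> \<in> l2 n" and "finite G"
  shows "A (\<lambda>w. of_bool (w \<in> G) * \<psi> w) = B (\<lambda>w. of_bool (w \<in> G) * \<psi> w)"
  using \<open>finite G\<close>
proof (induction G rule: finite_induct)
  case empty
  show ?case using bounded_op_cmult[OF A \<psi>, of 0] bounded_op_cmult[OF B \<psi>, of 0] by simp
next
  case (insert u G)
  show ?case
  proof (cases "u \<in> words n")
    case True
    have "(\<lambda>w. of_bool (w \<in> insert u G) * \<psi> w)
        = (\<lambda>w. 1 * (of_bool (w \<in> G) * \<psi> w) + \<psi> u * basis_vec u w)"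
      using insert.hyps by (auto simp: basis_vec_def fun_eq_iff)
    then show ?thesis
      by (simp only: insert.IH eq[OF True]
          bounded_op_lincomb[OF A l2_restrict[OF \<psi>] basis_vec_in_l2[OF True]]
          bounded_op_lincomb[OF B l2_restrict[OF \<psi>] basis_vec_in_l2[OF True]])
  next
    case False
    then have "(\<lambda>w. of_bool (w \<in> insert u G) * \<psi> w) = (\<lambda>w. of_bool (w \<in> G) * \<psi> w)"
      using l2_vanishes[OF \<psi>] by (auto simp: fun_eq_iff)
    then show ?thesis by (simp only: insert.IH)
  qed
qed

lemma bounded_op_eqI:
  assumes A: "bounded_op n A" and B: "bounded_op n B"
    and eq: "\<And>u. u \<in> words n \<Longrightarrow> A (basis_vec u) = B (basis_vec u)"
  shows "A = B"
proof
  fix \<psi>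
  show "A \<psi> = B \<psi>"
  proof (cases "\<psi> \<in> l2 n")
    case \<psi>: True
    let ?trunc = "\<lambda>G w. of_bool (w \<in> G) * \<psi> w"
    have lim: "l2_tendsto (\<lambda>G. T (?trunc G)) (T \<psi>) (finite_subsets_at_top UNIV)"
      if "bounded_op n T" for T
      by (rule bounded_op_l2_tendsto[OF that always_eventually \<psi> l2_tendsto_finite_truncation[OF \<psi>]])
        (simp add: l2_restrict[OF \<psi>])
    have "\<forall>\<^sub>F G in finite_subsets_at_top UNIV. B (?trunc G) = A (?trunc G)"
      by (rule eventually_finite_subsets_at_top_weakI)
        (rule bounded_op_eq_on_finite_truncation[OF A B eq \<psi>, symmetric])
    then have "\<forall>\<^sub>F G in finite_subsets_at_top UNIV.
        l2norm (\<lambda>w. B (?trunc G) w - B \<psi> w) = l2norm (\<lambda>w. A (?trunc G) w - B \<psi> w)"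
      by eventually_elim simp
    then have "l2_tendsto (\<lambda>G. A (?trunc G)) (B \<psi>) (finite_subsets_at_top UNIV)"
      using lim[OF B] unfolding l2_tendsto_def by (rule Lim_transform_eventually[rotated])
    then show ?thesis
      using bounded_op_in_l2[OF A] bounded_op_in_l2[OF B] l2_restrict[OF \<psi>] \<psi>
      by (intro l2_tendsto_unique[where n=n, OF finite_subsets_at_top_neq_bot always_eventually _
            lim[OF A]]) auto
  qed (simp add: bounded_op_outside[OF A] bounded_op_outside[OF B])
qed

lemma l2norm_le_opnorm:
  assumes T: "bounded_op n T" and \<psi>: "\<psi> \<in> l2 n"
  shows "l2norm (T \<psi>) \<le> opnorm n T * l2norm \<psi>"
proof -
  obtain C where C: "0 \<le> C" "\<And>\<psi>. \<psi> \<in> l2 n \<Longrightarrow> l2norm (T \<psi>) \<le> C * l2norm \<psi>"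
    using T by (rule bounded_op_boundE) blast
  show ?thesis
  proof (cases "l2norm \<psi> = 0")
    case True
    then show ?thesis using C(2)[OF \<psi>] by simp
  next
    case False
    then have pos: "l2norm \<psi> > 0" using l2norm_nonneg[of \<psi>] by simp
    define c where "c = complex_of_real (1 / l2norm \<psi>)"
    have norm_c: "cmod c = 1 / l2norm \<psi>" using pos by (simp add: c_def norm_divide)
    let ?values = "{l2norm (T \<phi>) | \<phi>. \<phi> \<in> l2 n \<and> l2norm \<phi> \<le> 1}"
    have "bdd_above ?values"
      using C(1) by (force intro!: bdd_aboveI[of _ C] order_trans[OF C(2)] mult_left_le)
    moreover have "l2norm (\<lambda>w. c * \<psi> w) \<le> 1" using pos by (simp add: l2norm_cmult norm_c)
    then have "l2norm (T (\<lambda>w. c * \<psi> w)) \<in> ?values" using l2_cmult[OF \<psi>] by blast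
    ultimately have "l2norm (T (\<lambda>w. c * \<psi> w)) \<le> opnorm n T"
      unfolding opnorm_def by (rule cSup_upper[rotated])
    then show ?thesis
      using pos by (simp add: bounded_op_cmult[OF T \<psi>] l2norm_cmult norm_c pos_divide_le_eq)
  qed
qed

lemma opnorm_leI:
  assumes "0 \<le> C" "\<And>\<psi>. \<psi> \<in> l2 n \<Longrightarrow> l2norm (T \<psi>) \<le> C * l2norm \<psi>"
  shows "opnorm n T \<le> C"
  unfolding opnorm_def
proof (rule cSup_least)
  show "{l2norm (T \<psi>) | \<psi>. \<psi> \<in> l2 n \<and> l2norm \<psi> \<le> 1} \<noteq> {}"
    using zero_vec_in_l2 l2norm_zero_vec by force
qed (use assms(1) in \<open>force intro!: order_trans[OF assms(2)] mult_left_le\<close>)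

lemma opnorm_le_1_iff:
  assumes T: "bounded_op n T"
  shows "opnorm n T \<le> 1 \<longleftrightarrow> (\<forall>\<psi>\<in>l2 n. l2norm (T \<psi>) \<le> l2norm \<psi>)"
proof
  assume le_1: "opnorm n T \<le> 1"
  show "\<forall>\<psi>\<in>l2 n. l2norm (T \<psi>) \<le> l2norm \<psi>"
    using l2norm_le_opnorm[OF T] mult_right_mono[OF le_1 l2norm_nonneg] by (force intro: order_trans)
qed (simp add: opnorm_leI)

lemma wot_closure_bounded_op: "T \<in> wot_closure n \<A> \<Longrightarrow> bounded_op n T"
  by (simp add: wot_closure_def)

lemma wot_closure_approx:
  assumes "T \<in> wot_closure n \<A>" "finite P" "P \<subseteq> l2 n \<times> l2 n" "0 < \<epsilon>"
  obtains B where "B \<in> \<A>" "\<And>x y. (x, y) \<in> P \<Longrightarrow> cmod (l2inner (T x) y - l2inner (B x) y) < \<epsilon>"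
proof -
  have "\<exists>B\<in>\<A>. \<forall>(x, y)\<in>P. cmod (l2inner (T x) y - l2inner (B x) y) < \<epsilon>"
    using assms unfolding wot_closure_def by blast
  then show ?thesis using that by auto
qed

lemma wot_closure_superset: "T \<in> \<A> \<Longrightarrow> bounded_op n T \<Longrightarrow> T \<in> wot_closure n \<A>"
  unfolding wot_closure_def by (auto intro!: bexI[of _ T])

lemma wot_closure_strong_limit:
  assumes T: "bounded_op n T" and F: "F \<noteq> bot"
    and X: "\<forall>\<^sub>F t in F. X t \<in> wot_closure n \<A>"
    and lim: "\<And>\<psi>. \<psi> \<in> l2 n \<Longrightarrow> l2_tendsto (\<lambda>t. X t \<psi>) (T \<psi>) F"
  shows "T \<in> wot_closure n \<A>"
proof -
  have "\<exists>B\<in>\<A>. \<forall>(x, y)\<in>P. cmod (l2inner (T x) y - l2inner (B x) y) < \<epsilon>"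
    if P: "finite P" "P \<subseteq> l2 n \<times> l2 n" and \<epsilon>: "\<epsilon> > 0" for P \<epsilon>
  proof -
    have "\<forall>\<^sub>F t in F. dist (l2inner (X t x) y) (l2inner (T x) y) < \<epsilon> / 2" if "(x, y) \<in> P" for x y
    proof (rule tendstoD[OF l2_tendsto_l2inner[where n=n]])
      show "\<forall>\<^sub>F t in F. X t x \<in> l2 n"
        using X
        by eventually_elim (use that P in \<open>auto intro: bounded_op_in_l2 wot_closure_bounded_op\<close>)
    qed (use lim that P \<epsilon> bounded_op_in_l2[OF T] in auto)
    then have "\<forall>\<^sub>F t in F. \<forall>(x, y)\<in>P. dist (l2inner (X t x) y) (l2inner (T x) y) < \<epsilon> / 2"
      by (intro eventually_ball_finite P) auto
    then obtain t where t: "X t \<in> wot_closure n \<A>"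
      and X_close: "\<And>x y. (x, y) \<in> P \<Longrightarrow> dist (l2inner (X t x) y) (l2inner (T x) y) < \<epsilon> / 2"
      using eventually_happens'[OF F eventually_conj[OF X]] by blast
    obtain B where "B \<in> \<A>"
      and B_close: "\<And>x y. (x, y) \<in> P \<Longrightarrow> cmod (l2inner (X t x) y - l2inner (B x) y) < \<epsilon> / 2"
      using wot_closure_approx[OF t P, of "\<epsilon> / 2"] \<epsilon> by auto
    moreover have "cmod (l2inner (T x) y - l2inner (B x) y) < \<epsilon>" if "(x, y) \<in> P" for x y
      using dist_triangle_half_r[of "l2inner (X t x) y"] X_close[OF that] B_close[OF that]
      by (simp only: dist_norm)
    ultimately show ?thesis by blast
  qed
  then show ?thesis using T unfolding wot_closure_def by blast
qed

section \<open>Power series in a creation operator\<close>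

definition lead_run :: "nat \<Rightarrow> nat list \<Rightarrow> nat" where
  "lead_run i w = length (takeWhile ((=) i) w)"

lemma lead_run_replicate_append: "v = [] \<or> hd v \<noteq> i \<Longrightarrow> lead_run i (replicate m i @ v) = m"
  by (cases v) (auto simp: lead_run_def takeWhile_append)

lemma replicate_lead_run_append_dropWhile: "replicate (lead_run i w) i @ dropWhile ((=) i) w = w"
proof -
  have "replicate (lead_run i w) i = takeWhile ((=) i) w"
    unfolding lead_run_def by (rule replicate_length_same) (auto dest: set_takeWhileD)
  then show ?thesis by simp
qed

lemma dropWhile_eq_Nil_or_hd_neq: "dropWhile ((=) i) w = [] \<or> hd (dropWhile ((=) i) w) \<noteq> i"
  using hd_dropWhile[of "(=) i" w] by metis

lemma lead_run_cases:
  obtains m v where "w = replicate m i @ v" "v = [] \<or> hd v \<noteq> i" "lead_run i w = m"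
  using that[OF replicate_lead_run_append_dropWhile[symmetric] dropWhile_eq_Nil_or_hd_neq] by simp

lemma inj_on_replicate_append:
  fixes i :: nat
  shows "inj_on (\<lambda>(v, m). replicate m i @ v) ({v. v = [] \<or> hd v \<noteq> i} \<times> UNIV)"
proof (rule inj_onI; clarsimp)
  fix v v' m m'
  assume "v = [] \<or> hd v \<noteq> i" "v' = [] \<or> hd v' \<noteq> i" and eq: "replicate m i @ v = replicate m' i @ v'"
  then have "m = m'"
    using lead_run_replicate_append[of v i m] lead_run_replicate_append[of v' i m'] by simp
  then show "v = v' \<and> m = m'" using eq by simp
qed

lemma finite_subset_replicate_append:
  fixes F :: "nat list set"
  assumes "finite F"
  obtains V N where "finite V" "V \<subseteq> {v. v = [] \<or> hd v \<noteq> i}"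
    "F \<subseteq> (\<lambda>(v, m). replicate m i @ v) ` (V \<times> {..<N})"
proof -
  obtain N where N: "\<And>w. w \<in> F \<Longrightarrow> lead_run i w < N"
    using assms finite_nat_set_iff_bounded[of "lead_run i ` F"] by auto
  show ?thesis
  proof (rule that)
    show "dropWhile ((=) i) ` F \<subseteq> {v. v = [] \<or> hd v \<noteq> i}"
      unfolding image_subset_iff mem_Collect_eq by (intro ballI dropWhile_eq_Nil_or_hd_neq)
    show "F \<subseteq> (\<lambda>(v, m). replicate m i @ v) ` (dropWhile ((=) i) ` F \<times> {..<N})"
    proof
      fix w assume "w \<in> F"
      then show "w \<in> (\<lambda>(v, m). replicate m i @ v) ` (dropWhile ((=) i) ` F \<times> {..<N})"
        using N replicate_lead_run_append_dropWhile[of i w, symmetric]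
        by (intro image_eqI[of _ _ "(dropWhile ((=) i) w, lead_run i w)"]) auto
    qed
  qed (simp add: assms)
qed

text \<open>\<open>creation_series n i b\<close> is \<open>\<Sum>\<^sub>k b\<^sub>k S\<^sup>k\<close> for \<open>S = creation n i\<close>: in each coordinate only finitely many
  terms contribute.\<close>

definition creation_series :: "nat \<Rightarrow> nat \<Rightarrow> (nat \<Rightarrow> complex) \<Rightarrow> op" where
  "creation_series n i b \<psi> =
    (if \<psi> \<in> l2 n then (\<lambda>w. \<Sum>k\<le>lead_run i w. b k * \<psi> (drop k w)) else zero_vec)"

lemma creation_series_outside: "\<psi> \<notin> l2 n \<Longrightarrow> creation_series n i b \<psi> = zero_vec"
  by (simp add: creation_series_def)

lemma creation_series_replicate_append:
  assumes "\<psi> \<in> l2 n" "v = [] \<or> hd v \<noteq> i"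
  shows "creation_series n i b \<psi> (replicate m i @ v) = (\<Sum>k\<le>m. b k * \<psi> (replicate (m - k) i @ v))"
  using assms by (simp add: creation_series_def lead_run_replicate_append)

lemma sum_power2_creation_series_le:
  assumes b: "disc_bounded b M" and \<psi>: "\<psi> \<in> l2 n" and F: "finite F"
  shows "(\<Sum>w\<in>F. (cmod (creation_series n i b \<psi> w))\<^sup>2) \<le> (M * l2norm \<psi>)\<^sup>2"
proof -
  obtain V N where V: "finite V" "V \<subseteq> {v. v = [] \<or> hd v \<noteq> i}"
    and sub: "F \<subseteq> (\<lambda>(v, m). replicate m i @ v) ` (V \<times> {..<N})" (is "_ \<subseteq> ?W")
    using finite_subset_replicate_append[OF F] by blast
  have inj: "inj_on (\<lambda>(v, m). replicate m i @ v) (V \<times> {..<N})"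
    by (rule inj_on_subset[OF inj_on_replicate_append]) (use V in auto)
  have sum_W: "(\<Sum>w\<in>?W. h w) = (\<Sum>v\<in>V. \<Sum>m<N. h (replicate m i @ v))" for h :: "nat list \<Rightarrow> real"
    by (subst sum.reindex[OF inj]) (simp add: sum.cartesian_product case_prod_beta)
  have "(\<Sum>w\<in>F. (cmod (creation_series n i b \<psi> w))\<^sup>2) \<le> (\<Sum>w\<in>?W. (cmod (creation_series n i b \<psi> w))\<^sup>2)"
    by (rule sum_mono2) (use sub V in auto)
  also have "\<dots> = (\<Sum>v\<in>V. \<Sum>m<N. (cmod (\<Sum>k\<le>m. b k * \<psi> (replicate (m - k) i @ v)))\<^sup>2)"
    unfolding sum_W using V(2)
    by (intro sum.cong refl) (simp add: creation_series_replicate_append[OF \<psi>] subset_iff)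
  also have "\<dots> \<le> (\<Sum>v\<in>V. M\<^sup>2 * (\<Sum>m<N. (cmod (\<psi> (replicate m i @ v)))\<^sup>2))"
    by (intro sum_mono toeplitz_bound_disc_bounded[OF b])
  also have "\<dots> = M\<^sup>2 * (\<Sum>w\<in>?W. (cmod (\<psi> w))\<^sup>2)" by (simp add: sum_W sum_distrib_left)
  also have "\<dots> \<le> M\<^sup>2 * (l2norm \<psi>)\<^sup>2"
    using V by (intro mult_left_mono sum_power2_le_l2norm_power2[OF \<psi>]) auto
  finally show ?thesis by (simp add: power_mult_distrib)
qed

lemma creation_series_bound:
  assumes i: "i < n" and b: "disc_bounded b M" and \<psi>: "\<psi> \<in> l2 n"
  shows creation_series_in_l2: "creation_series n i b \<psi> \<in> l2 n"
    and l2norm_creation_series_le: "l2norm (creation_series n i b \<psi>) \<le> M * l2norm \<psi>"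
proof -
  have vanishes: "creation_series n i b \<psi> w = 0" if "w \<notin> words n" for w
  proof (rule lead_run_cases[of w i])
    fix m v assume w: "w = replicate m i @ v" "v = [] \<or> hd v \<noteq> i"
    then have "v \<notin> words n" using that i by simp
    then show ?thesis using w l2_vanishes[OF \<psi>] by (simp add: creation_series_replicate_append[OF \<psi>])
  qed
  have bound: "L2_set (\<lambda>w. cmod (creation_series n i b \<psi> w)) F \<le> M * l2norm \<psi>" if "finite F" for F
    unfolding L2_set_def
    by (intro real_le_lsqrt sum_power2_creation_series_le[OF b \<psi> that] mult_nonneg_nonneg l2norm_nonneg
        disc_bounded_nonneg[OF b])
  show "creation_series n i b \<psi> \<in> l2 n" "l2norm (creation_series n i b \<psi>) \<le> M * l2norm \<psi>"
    by (rule l2I_L2_set_bounded[OF vanishes bound]; assumption)+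
qed

lemma creation_series_lincomb:
  assumes "\<psi> \<in> l2 n" "\<phi> \<in> l2 n"
  shows "creation_series n i b (\<lambda>w. a * \<psi> w + c * \<phi> w)
    = (\<lambda>w. a * creation_series n i b \<psi> w + c * creation_series n i b \<phi> w)"
  using l2_lincomb[OF assms] assms
  by (auto simp: creation_series_def fun_eq_iff sum_distrib_left algebra_simps simp flip: sum.distrib)

lemma bounded_op_creation_series:
  assumes "i < n" "disc_bounded b M"
  shows "bounded_op n (creation_series n i b)"
  unfolding bounded_op_def
  using creation_series_bound[OF assms] creation_series_lincomb creation_series_outside by blast

lemma creation_series_lincomb_coeff:
  "creation_series n i (\<lambda>k. a * b k + c * d k) \<psi>
    = (\<lambda>w. a * creation_series n i b \<psi> w + c * creation_series n i d \<psi> w)"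
  by (auto simp: creation_series_def zero_vec_def fun_eq_iff sum_distrib_left algebra_simps
      simp flip: sum.distrib)

lemma creation_series_diff_coeff:
  "creation_series n i (\<lambda>k. b k - c k) \<psi>
    = (\<lambda>w. creation_series n i b \<psi> w - creation_series n i c \<psi> w)"
  using creation_series_lincomb_coeff[of n i 1 b "-1" c \<psi>] by simp

lemma creation_in_l2:
  assumes "i < n" "\<psi> \<in> l2 n"
  shows "creation n i \<psi> \<in> l2 n"
  by (rule l2_reindex[OF assms(2), of "(#) i"])
     (use assms in \<open>auto simp: creation_def split: list.splits\<close>)

lemma creation_funpow_in_l2:
  assumes "i < n" "\<psi> \<in> l2 n"
  shows "(creation n i ^^ k) \<psi> \<in> l2 n"
  by (induction k) (use assms in \<open>auto intro: creation_in_l2\<close>)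

lemma creation_funpow_apply:
  assumes "i < n" "\<psi> \<in> l2 n"
  shows "(creation n i ^^ k) \<psi> w = (if k \<le> lead_run i w then \<psi> (drop k w) else 0)"
proof (induction k arbitrary: w)
  case (Suc k)
  have "(creation n i ^^ Suc k) \<psi> w
      = (case w of [] \<Rightarrow> 0 | j # v \<Rightarrow> if j = i then (creation n i ^^ k) \<psi> v else 0)"
    using creation_funpow_in_l2[OF assms, of k]
    by (simp add: creation_def[of n i "(creation n i ^^ k) \<psi>"])
  also have "\<dots> = (if Suc k \<le> lead_run i w then \<psi> (drop (Suc k) w) else 0)"
    using Suc.IH by (cases w) (auto simp: lead_run_def)
  finally show ?case .
qed simp

abbreviation truncate_coeffs :: "nat \<Rightarrow> (nat \<Rightarrow> complex) \<Rightarrow> nat \<Rightarrow> complex" where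
  "truncate_coeffs N b \<equiv> (\<lambda>k. if k < N then b k else 0)"

lemma summable_truncate_coeffs: "summable (\<lambda>k. cmod (truncate_coeffs N b k))"
  by (rule summable_finite[of "{..<N}"]) auto

lemma sum_creation_funpow:
  assumes "i < n" "\<psi> \<in> l2 n"
  shows "(\<lambda>w. \<Sum>k<N. b k * (creation n i ^^ k) \<psi> w)
    = creation_series n i (truncate_coeffs N b) \<psi>"
proof
  fix w
  have "(\<Sum>k<N. b k * (creation n i ^^ k) \<psi> w) = (\<Sum>k\<in>{..<N} \<inter> {..lead_run i w}. b k * \<psi> (drop k w))"
    unfolding creation_funpow_apply[OF assms] by (rule sum.mono_neutral_cong_right) auto
  also have "\<dots> = (\<Sum>k\<le>lead_run i w. (if k < N then b k else 0) * \<psi> (drop k w))"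
    by (rule sum.mono_neutral_cong_left) auto
  finally show "(\<Sum>k<N. b k * (creation n i ^^ k) \<psi> w) = creation_series n i (truncate_coeffs N b) \<psi> w"
    using assms(2) by (simp add: creation_series_def)
qed

lemma creation_power_in_alg_gen:
  assumes "i < n"
  shows "(\<lambda>\<psi>. if \<psi> \<in> l2 n then (creation n i ^^ k) \<psi> else zero_vec) \<in> alg_gen n" (is "?S k \<in> _")
proof (induction k)
  case 0
  have "?S 0 = id_op n" by (auto simp: id_op_def)
  then show ?case by (simp only: gen_id)
next
  case (Suc k)
  have "?S (Suc k) = creation n i \<circ> ?S k"
    by (auto simp: creation_def zero_vec_in_l2 zero_vec_def fun_eq_iff split: list.splits)
  then show ?case using gen_comp[OF gen_S[OF assms] Suc.IH] by (simp only:)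
qed

lemma truncated_creation_series_in_alg_gen:
  assumes "i < n"
  shows "creation_series n i (truncate_coeffs N b) \<in> alg_gen n"
proof (induction N)
  case 0
  have "creation_series n i (truncate_coeffs 0 b) = (\<lambda>\<psi> w. 0 * id_op n \<psi> w)"
    by (simp add: creation_series_def zero_vec_def fun_eq_iff)
  then show ?case using gen_smult[OF gen_id, where c=0] by simp
next
  case (Suc N)
  let ?S = "\<lambda>\<psi>. if \<psi> \<in> l2 n then (creation n i ^^ N) \<psi> else zero_vec"
  have "creation_series n i (truncate_coeffs (Suc N) b)
      = (\<lambda>\<psi> w. creation_series n i (truncate_coeffs N b) \<psi> w + b N * ?S \<psi> w)"
  proof
    fix \<psi>
    show "creation_series n i (truncate_coeffs (Suc N) b) \<psi>
      = (\<lambda>w. creation_series n i (truncate_coeffs N b) \<psi> w + b N * ?S \<psi> w)"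
      by (cases "\<psi> \<in> l2 n")
        (simp_all add: creation_series_outside zero_vec_def flip: sum_creation_funpow[OF assms])
  qed
  then show ?case
    using gen_add[OF Suc.IH gen_smult[OF creation_power_in_alg_gen[OF assms]]] by simp
qed

lemma truncated_creation_series_tendsto:
  assumes i: "i < n" and b: "summable (\<lambda>k. cmod (b k))" and \<psi>: "\<psi> \<in> l2 n"
  shows "l2_tendsto (\<lambda>N. creation_series n i (truncate_coeffs N b) \<psi>) (creation_series n i b \<psi>)
    sequentially"
proof -
  let ?tail = "\<lambda>N k. (if k < N then b k else 0) - b k"
  have summable_tail: "summable (\<lambda>k. cmod (?tail N k))" for N
    by (rule summable_comparison_test'[OF b]) simp
  have suminf_tail: "(\<Sum>k. cmod (?tail N k)) = (\<Sum>k. cmod (b (k + N)))" for N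
    using suminf_split_initial_segment[OF summable_tail[of N], of N] by simp
  have bound: "l2norm (creation_series n i (?tail N) \<psi>) \<le> (\<Sum>k. cmod (b (k + N))) * l2norm \<psi>" for N
    using l2norm_creation_series_le[OF i disc_bounded_abs_summable[OF summable_tail] \<psi>]
    by (simp only: suminf_tail)
  show ?thesis
  proof (rule l2_tendstoI[OF always_eventually])
    show "(\<lambda>N. (\<Sum>k. cmod (b (k + N))) * l2norm \<psi>) \<longlonglongrightarrow> 0"
      by (rule tendsto_mult_left_zero[OF suminf_exist_split2[OF b]])
  qed (use bound in \<open>simp add: creation_series_diff_coeff\<close>)
qed

text \<open>The diagonal contractions \<open>dilate i r\<close> intertwine \<open>\<Sum>\<^sub>k b\<^sub>k S\<^sup>k\<close> and \<open>\<Sum>\<^sub>k b\<^sub>k r\<^sup>k S\<^sup>k\<close>, which reduces the limit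
  \<open>r \<rightarrow> 1\<close> to that of these contractions.\<close>

definition dilate :: "nat \<Rightarrow> real \<Rightarrow> vec \<Rightarrow> vec" where
  "dilate i r \<psi> w = complex_of_real r ^ lead_run i w * \<psi> w"

lemma dilate_in_l2:
  assumes "0 \<le> r" "r \<le> 1" "\<psi> \<in> l2 n"
  shows "dilate i r \<psi> \<in> l2 n"
  by (rule l2_dominated(1)[OF assms(3), of _ 1])
    (use assms in \<open>auto simp: dilate_def norm_mult norm_power power_le_one
      intro!: mult_left_le_one_le\<close>)

lemma l2_tendsto_dilate:
  assumes "\<psi> \<in> l2 n"
  shows "l2_tendsto (\<lambda>r. dilate i r \<psi>) \<psi> (at_left 1)"
proof -
  let ?c = "\<lambda>r w. complex_of_real r ^ lead_run i w - 1"
  have "((\<lambda>r. l2norm (\<lambda>w. ?c r w * \<psi> w)) \<longlongrightarrow> 0) (at_left 1)"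
  proof (rule l2norm_multiplier_tendsto_0[OF assms])
    have "cmod (?c r w) \<le> 1" if "0 < r" "r < 1" for r w
    proof -
      have "0 \<le> r ^ lead_run i w" "r ^ lead_run i w \<le> 1" using that by (auto simp: power_le_one)
      moreover have "?c r w = complex_of_real (r ^ lead_run i w - 1)" by simp
      ultimately show ?thesis by (simp only: norm_of_real)
    qed
    then show "\<forall>\<^sub>F r in at_left 1. \<forall>w. cmod (?c r w) \<le> 1" by (intro eventually_at_leftI[of 0]) auto
    have "((\<lambda>r. ?c r w) \<longlongrightarrow> ?c 1 w) (at_left 1)" for w by (intro tendsto_intros)
    then show "((\<lambda>r. ?c r w) \<longlongrightarrow> 0) (at_left 1)" for w by simp
  qed simp
  then show ?thesis by (simp add: l2_tendsto_def dilate_def algebra_simps)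
qed

lemma creation_series_dilate:
  assumes "0 \<le> r" "r \<le> 1" and \<psi>: "\<psi> \<in> l2 n"
  shows "creation_series n i (dilate_coeffs r b) (dilate i r \<psi>) = dilate i r (creation_series n i b \<psi>)"
proof
  fix w
  show "creation_series n i (dilate_coeffs r b) (dilate i r \<psi>) w = dilate i r (creation_series n i b \<psi>) w"
  proof (rule lead_run_cases[of w i])
    fix m v assume w: "w = replicate m i @ v" "v = [] \<or> hd v \<noteq> i"
    have "creation_series n i (dilate_coeffs r b) (dilate i r \<psi>) w
        = (\<Sum>k\<le>m. dilate_coeffs r b k * (complex_of_real r ^ (m - k) * \<psi> (replicate (m - k) i @ v)))"
      using w by (simp add: creation_series_replicate_append dilate_in_l2 assms dilate_def
          lead_run_replicate_append)
    also have "\<dots> = (\<Sum>k\<le>m. complex_of_real r ^ m * (b k * \<psi> (replicate (m - k) i @ v)))"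
    proof (intro sum.cong refl)
      fix k assume "k \<in> {..m}"
      then have "complex_of_real r ^ m = complex_of_real r ^ k * complex_of_real r ^ (m - k)"
        by (simp flip: power_add)
      then show "dilate_coeffs r b k * (complex_of_real r ^ (m - k) * \<psi> (replicate (m - k) i @ v))
          = complex_of_real r ^ m * (b k * \<psi> (replicate (m - k) i @ v))" by simp
    qed
    also have "\<dots> = dilate i r (creation_series n i b \<psi>) w"
      using w by (simp add: creation_series_replicate_append[OF \<psi>] dilate_def lead_run_replicate_append
          sum_distrib_left)
    finally show ?thesis .
  qed
qed

lemma dilated_creation_series_tendsto:
  assumes i: "i < n" and b: "disc_bounded b M" and \<psi>: "\<psi> \<in> l2 n"
  shows "l2_tendsto (\<lambda>r. creation_series n i (dilate_coeffs r b) \<psi>) (creation_series n i b \<psi>) (at_left 1)"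
proof -
  let ?S = "creation_series n i b" and ?S' = "\<lambda>r. creation_series n i (dilate_coeffs r b)"
  let ?err = "\<lambda>\<phi> r w. dilate i r \<phi> w - \<phi> w"
  have S\<psi>: "?S \<psi> \<in> l2 n" by (rule creation_series_in_l2[OF i b \<psi>])
  have bound: "l2norm (\<lambda>w. ?S' r \<psi> w - ?S \<psi> w) \<le> l2norm (?err (?S \<psi>) r) + M * l2norm (?err \<psi> r)"
    if r: "0 < r" "r < 1" for r
  proof -
    have r': "0 \<le> r" "r \<le> 1" using r by auto
    note b' = disc_bounded_dilate[OF b r']
    have err: "?err \<phi> r \<in> l2 n" if "\<phi> \<in> l2 n" for \<phi> by (intro l2_diff dilate_in_l2 r' that)
    have "?S' r (?err \<psi> r) = (\<lambda>w. dilate i r (?S \<psi>) w - ?S' r \<psi> w)"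
      using bounded_op_diff[OF bounded_op_creation_series[OF i b'] dilate_in_l2[OF r' \<psi>] \<psi>]
      by (simp only: creation_series_dilate[OF r' \<psi>])
    then have "l2norm (\<lambda>w. ?S' r \<psi> w - ?S \<psi> w) = l2norm (\<lambda>w. ?err (?S \<psi>) r w - ?S' r (?err \<psi> r) w)"
      by simp
    also have "\<dots> \<le> l2norm (?err (?S \<psi>) r) + l2norm (?S' r (?err \<psi> r))"
      by (rule l2norm_diff_le[OF err[OF S\<psi>] creation_series_in_l2[OF i b' err[OF \<psi>]]])
    also have "\<dots> \<le> l2norm (?err (?S \<psi>) r) + M * l2norm (?err \<psi> r)"
      using l2norm_creation_series_le[OF i b' err[OF \<psi>]] by simp
    finally show ?thesis .
  qed
  show ?thesis
  proof (rule l2_tendstoI)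
    show "\<forall>\<^sub>F r in at_left 1. l2norm (\<lambda>w. ?S' r \<psi> w - ?S \<psi> w)
        \<le> l2norm (?err (?S \<psi>) r) + M * l2norm (?err \<psi> r)"
      by (rule eventually_at_leftI[of 0]) (auto intro: bound)
    have "((\<lambda>r. l2norm (?err (?S \<psi>) r) + M * l2norm (?err \<psi> r)) \<longlongrightarrow> 0 + M * 0) (at_left 1)"
      using l2_tendsto_dilate[OF S\<psi>] l2_tendsto_dilate[OF \<psi>] unfolding l2_tendsto_def
      by (intro tendsto_intros)
    then show "((\<lambda>r. l2norm (?err (?S \<psi>) r) + M * l2norm (?err \<psi> r)) \<longlongrightarrow> 0) (at_left 1)" by simp
  qed
qed

lemma abs_summable_creation_series_in_Fn_inf:
  assumes i: "i < n" and b: "summable (\<lambda>k. cmod (b k))"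
  shows "creation_series n i b \<in> Fn_inf n"
  unfolding Fn_inf_def
proof (rule wot_closure_strong_limit[OF _ sequentially_bot always_eventually])
  show "bounded_op n (creation_series n i b)"
    by (rule bounded_op_creation_series[OF i disc_bounded_abs_summable[OF b]])
  show "\<forall>N. creation_series n i (truncate_coeffs N b) \<in> wot_closure n (alg_gen n)"
    by (intro allI wot_closure_superset truncated_creation_series_in_alg_gen[OF i]
        bounded_op_creation_series[OF i disc_bounded_abs_summable[OF summable_truncate_coeffs]])
qed (rule truncated_creation_series_tendsto[OF i b])

lemma creation_series_in_Fn_inf:
  assumes i: "i < n" and b: "disc_bounded b M"
  shows "creation_series n i b \<in> Fn_inf n"
  unfolding Fn_inf_def
proof (rule wot_closure_strong_limit[OF bounded_op_creation_series[OF assms] trivial_limit_at_left_real])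
  show "\<forall>\<^sub>F r in at_left 1. creation_series n i (dilate_coeffs r b) \<in> wot_closure n (alg_gen n)"
    using abs_summable_creation_series_in_Fn_inf[OF i disc_bounded_dilate_abs_summable[OF b]]
    by (intro eventually_at_leftI[of 0]) (auto simp: Fn_inf_def)
qed (rule dilated_creation_series_tendsto[OF assms])

section \<open>The functional calculus\<close>

lemma Hinf_holomorphic: "f \<in> Hinf \<Longrightarrow> f holomorphic_on ball 0 1"
  by (simp add: Hinf_def)

lemma Hinf_outside: "f \<in> Hinf \<Longrightarrow> 1 \<le> cmod z \<Longrightarrow> f z = 0"
  by (simp add: Hinf_def)

lemma Hinf_taylor_sums: "f \<in> Hinf \<Longrightarrow> cmod z < 1 \<Longrightarrow> (\<lambda>k. taylor_coeff f k * z ^ k) sums f z"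
  using holomorphic_power_series[of f 0 1 z] by (simp add: Hinf_holomorphic taylor_coeff_def)

lemma Hinf_eqI_taylor_coeff:
  assumes "f \<in> Hinf" "g \<in> Hinf" "taylor_coeff f = taylor_coeff g"
  shows "f = g"
proof
  fix z
  show "f z = g z"
    using assms Hinf_taylor_sums[of f z] Hinf_taylor_sums[of g z] sums_unique2
    by (cases "cmod z < 1") (auto simp: Hinf_outside)
qed

lemma disc_bounded_taylor_coeff_iff:
  "f \<in> Hinf \<Longrightarrow> disc_bounded (taylor_coeff f) M \<longleftrightarrow> (\<forall>z. cmod z < 1 \<longrightarrow> cmod (f z) \<le> M)"
  using Hinf_taylor_sums[of f] by (auto simp: disc_bounded_def sums_iff)

lemma Hinf_disc_boundedE:
  assumes "f \<in> Hinf"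
  obtains M where "disc_bounded (taylor_coeff f) M"
proof -
  obtain M where "\<forall>x\<in>f ` ball 0 1. cmod x \<le> M" using assms by (auto simp: Hinf_def bounded_iff)
  then show ?thesis using that[of M] by (simp add: disc_bounded_taylor_coeff_iff[OF assms])
qed

lemma taylor_coeff_lincomb:
  assumes "g holomorphic_on ball 0 1" "h holomorphic_on ball 0 1"
  shows "taylor_coeff (\<lambda>z. a * g z + b * h z) k = a * taylor_coeff g k + b * taylor_coeff h k"
proof -
  have "(\<lambda>z. a * g z) holomorphic_on ball 0 1" "(\<lambda>z. b * h z) holomorphic_on ball 0 1"
    using assms by (auto intro!: holomorphic_intros)
  then show ?thesis
    unfolding taylor_coeff_def
    by (simp add: higher_deriv_add higher_deriv_cmult[OF assms(1)] higher_deriv_cmult[OF assms(2)]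
        add_divide_distrib)
qed

lemma fun_calc_r_eq_creation_series:
  assumes n: "0 < n" and f: "f \<in> Hinf" and r: "0 \<le> r" "r < 1"
  shows "fun_calc_r n f r = creation_series n 0 (dilate_coeffs r (taylor_coeff f))"
proof
  fix \<psi>
  let ?b = "dilate_coeffs r (taylor_coeff f)"
  obtain M where "disc_bounded (taylor_coeff f) M" using f by (rule Hinf_disc_boundedE)
  then have b: "summable (\<lambda>k. cmod (?b k))" using r by (rule disc_bounded_dilate_abs_summable)
  show "fun_calc_r n f r \<psi> = creation_series n 0 ?b \<psi>"
  proof (cases "\<psi> \<in> l2 n")
    case True
    have "l2_lim n sequentially (\<lambda>N. creation_series n 0 (truncate_coeffs N ?b) \<psi>)
        = creation_series n 0 ?b \<psi>"
      by (intro l2_lim_eqI[OF sequentially_bot always_eventually] allI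
          creation_series_in_l2[OF n disc_bounded_abs_summable[OF b] True]
          creation_series_in_l2[OF n disc_bounded_abs_summable[OF summable_truncate_coeffs] True]
          truncated_creation_series_tendsto[OF n b True])
    then show ?thesis using True by (simp add: fun_calc_r_def sum_creation_funpow[OF n True])
  qed (simp add: fun_calc_r_def creation_series_outside)
qed

lemma fun_calc_eq_creation_series:
  assumes n: "0 < n" and f: "f \<in> Hinf"
  shows "fun_calc n f = creation_series n 0 (taylor_coeff f)"
proof
  fix \<psi>
  obtain M where b: "disc_bounded (taylor_coeff f) M" using f by (rule Hinf_disc_boundedE)
  show "fun_calc n f \<psi> = creation_series n 0 (taylor_coeff f) \<psi>"
  proof (cases "\<psi> \<in> l2 n")
    case True
    let ?S = "\<lambda>r. creation_series n 0 (dilate_coeffs r (taylor_coeff f)) \<psi>"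
    have eq: "\<forall>\<^sub>F r in at_left 1. ?S r = fun_calc_r n f r \<psi>"
      by (rule eventually_at_leftI[of 0]) (simp_all add: fun_calc_r_eq_creation_series[OF n f])
    have "\<forall>\<^sub>F r in at_left 1. ?S r \<in> l2 n"
      using creation_series_in_l2[OF n disc_bounded_dilate[OF b] True]
      by (intro eventually_at_leftI[of 0]) auto
    then have in_l2: "\<forall>\<^sub>F r in at_left 1. fun_calc_r n f r \<psi> \<in> l2 n"
      using eq by eventually_elim simp
    have "l2_tendsto (\<lambda>r. fun_calc_r n f r \<psi>) (creation_series n 0 (taylor_coeff f) \<psi>) (at_left 1)"
      using dilated_creation_series_tendsto[OF n b True] unfolding l2_tendsto_def
      by (rule Lim_transform_eventually) (rule eventually_mono[OF eq], simp)
    then show ?thesis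
      using True l2_lim_eqI[OF trivial_limit_at_left_real in_l2 creation_series_in_l2[OF n b True]]
      by (simp add: fun_calc_def)
  qed (simp add: fun_calc_def creation_series_outside)
qed

lemma fun_calc_in_Fn_inf: "0 < n \<Longrightarrow> f \<in> Hinf \<Longrightarrow> fun_calc n f \<in> Fn_inf n"
  by (metis Hinf_disc_boundedE creation_series_in_Fn_inf fun_calc_eq_creation_series)

lemma fun_calc_lincomb:
  assumes n: "0 < n" and f: "(\<lambda>z. a * g z + b * h z) \<in> Hinf" and g: "g \<in> Hinf" and h: "h \<in> Hinf"
  shows "fun_calc n (\<lambda>z. a * g z + b * h z) = (\<lambda>\<psi> w. a * fun_calc n g \<psi> w + b * fun_calc n h \<psi> w)"
  using creation_series_lincomb_coeff[of n 0 a "taylor_coeff g" b "taylor_coeff h"]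
  by (simp add: fun_calc_eq_creation_series[OF n] f g h fun_eq_iff
      taylor_coeff_lincomb[OF Hinf_holomorphic[OF g] Hinf_holomorphic[OF h], THEN ext])

lemma fun_calc_vacuum:
  assumes "0 < n" "f \<in> Hinf"
  shows "fun_calc n f vacuum (replicate j 0) = taylor_coeff f j"
proof -
  have "fun_calc n f vacuum (replicate j 0) = (\<Sum>k\<le>j. taylor_coeff f k * of_bool (k = j))"
    using creation_series_replicate_append[of vacuum n "[]" 0 "taylor_coeff f" j]
    by (auto simp: fun_calc_eq_creation_series[OF assms] basis_vec_in_l2 basis_vec_def
        intro!: sum.cong)
  then show ?thesis by (simp add: of_bool_def if_distrib cong: if_cong)
qed

lemma fun_calc_inj:
  assumes "0 < n" "f \<in> Hinf" "g \<in> Hinf" "fun_calc n f = fun_calc n g"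
  shows "f = g"
proof (rule Hinf_eqI_taylor_coeff[OF assms(2,3)])
  show "taylor_coeff f = taylor_coeff g"
    using assms fun_calc_vacuum[of n] by (metis ext)
qed

section \<open>Commutation with right creation operators\<close>

lemma Fn_inf_bounded_op: "T \<in> Fn_inf n \<Longrightarrow> bounded_op n T"
  unfolding Fn_inf_def by (rule wot_closure_bounded_op)

definition right_creation :: "nat \<Rightarrow> vec \<Rightarrow> vec" where
  "right_creation i \<psi> w = (if w \<noteq> [] \<and> last w = i then \<psi> (butlast w) else 0)"

lemma right_creation_simps [simp]:
  "right_creation i \<psi> [] = 0"
  "right_creation i \<psi> (w @ [j]) = (if j = i then \<psi> w else 0)"
  by (simp_all add: right_creation_def)

lemma right_creation_basis_vec: "right_creation i (basis_vec u) = basis_vec (u @ [i])"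
proof
  show "right_creation i (basis_vec u) w = basis_vec (u @ [i]) w" for w
    by (cases w rule: rev_cases) (auto simp: basis_vec_def)
qed

lemma right_creation_in_l2:
  assumes "i < n" "\<psi> \<in> l2 n"
  shows "right_creation i \<psi> \<in> l2 n"
proof (rule l2_reindex[OF assms(2), of "\<lambda>w. w @ [i]"])
  show "right_creation i \<psi> w = 0" if "w \<notin> range (\<lambda>w. w @ [i])" for w
    using that by (cases w rule: rev_cases) auto
qed (use assms in \<open>auto simp: inj_def\<close>)

lemma alg_gen_in_l2: "A \<in> alg_gen n \<Longrightarrow> \<psi> \<in> l2 n \<Longrightarrow> A \<psi> \<in> l2 n"
  by (induction arbitrary: \<psi> rule: alg_gen.induct)
     (auto simp: id_op_def creation_in_l2 l2_add l2_cmult)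

lemma alg_gen_right_creation:
  assumes "A \<in> alg_gen n" "\<psi> \<in> l2 n" "i < n"
  shows "A (right_creation i \<psi>) = right_creation i (A \<psi>)"
  using assms(1,2)
proof (induction arbitrary: \<psi> rule: alg_gen.induct)
  case gen_id
  then show ?case using assms(3) by (simp add: id_op_def right_creation_in_l2)
next
  case (gen_S j)
  have "creation n j (right_creation i \<psi>) w = right_creation i (creation n j \<psi>) w" for w
    using gen_S right_creation_in_l2[OF assms(3), of \<psi>]
    by (cases w) (auto simp: creation_def right_creation_def)
  then show ?case by (rule ext)
next
  case (gen_comp A B)
  then show ?case by (simp add: alg_gen_in_l2)
qed (auto simp: right_creation_def fun_eq_iff)

lemma Fn_inf_right_creation:
  assumes T: "T \<in> Fn_inf n" and \<psi>: "\<psi> \<in> l2 n" and i: "i < n"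
  shows "T (right_creation i \<psi>) = right_creation i (T \<psi>)"
proof
  fix w
  let ?R = "right_creation i"
  note T' = Fn_inf_bounded_op[OF T]
  have R\<psi>: "?R \<psi> \<in> l2 n" by (rule right_creation_in_l2[OF i \<psi>])
  show "T (?R \<psi>) w = ?R (T \<psi>) w"
  proof (cases "w \<in> words n")
    case False
    then show ?thesis
      using l2_vanishes[OF bounded_op_in_l2[OF T' R\<psi>]]
        l2_vanishes[OF right_creation_in_l2[OF i bounded_op_in_l2[OF T' \<psi>]]] by simp
  next
    case True
    then have "butlast w \<in> words n" by (auto simp: words_def dest: in_set_butlastD)
    let ?P = "{(?R \<psi>, basis_vec w), (\<psi>, basis_vec (butlast w))}"
    have P: "finite ?P" "?P \<subseteq> l2 n \<times> l2 n"
      using R\<psi> \<psi> basis_vec_in_l2 True \<open>butlast w \<in> words n\<close> by auto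
    have "dist (T (?R \<psi>) w) (?R (T \<psi>) w) \<le> \<epsilon>" if \<epsilon>: "0 < \<epsilon>" for \<epsilon>
    proof -
      obtain B where B: "B \<in> alg_gen n"
        and close: "\<And>x y. (x, y) \<in> ?P \<Longrightarrow> cmod (l2inner (T x) y - l2inner (B x) y) < \<epsilon> / 2"
        using wot_closure_approx[OF T[unfolded Fn_inf_def] P half_gt_zero[OF \<epsilon>]] by blast
      have "dist (T (?R \<psi>) w) (B (?R \<psi>) w) < \<epsilon> / 2"
        using close[of "?R \<psi>" "basis_vec w"] by (simp add: l2inner_basis_vec dist_norm)
      moreover have "dist (?R (T \<psi>) w) (B (?R \<psi>) w) < \<epsilon> / 2"
        using close[of \<psi> "basis_vec (butlast w)"] \<epsilon>
        by (simp add: alg_gen_right_creation[OF B \<psi> i] right_creation_def l2inner_basis_vec dist_norm)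
      ultimately show ?thesis using dist_triangle_half_l by fastforce
    qed
    then show ?thesis using field_le_epsilon[of "dist (T (?R \<psi>) w) (?R (T \<psi>) w)" 0] by simp
  qed
qed

lemma Fn_inf_eqI:
  assumes A: "A \<in> Fn_inf n" and B: "B \<in> Fn_inf n" and vacuum: "A vacuum = B vacuum"
  shows "A = B"
proof (rule bounded_op_eqI[OF Fn_inf_bounded_op[OF A] Fn_inf_bounded_op[OF B]])
  show "A (basis_vec u) = B (basis_vec u)" if "u \<in> words n" for u
    using that
  proof (induction u rule: rev_induct)
    case (snoc i u)
    then have u: "basis_vec u \<in> l2 n" "i < n" by (simp_all add: basis_vec_in_l2)
    then show ?case
      using snoc Fn_inf_right_creation[OF A u] Fn_inf_right_creation[OF B u]
      by (simp add: right_creation_basis_vec)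
  qed (rule vacuum)
qed

section \<open>Szego kernels\<close>

text \<open>\<open>kernel_vec i v z\<close> is the Szego kernel at z on the copy of the Hardy space spanned by the words
  \<open>v i\<^sup>m\<close>; it is an eigenvector of the adjoint of \<open>right_creation i\<close> unless v ends in i.\<close>

definition kernel_vec :: "nat \<Rightarrow> nat list \<Rightarrow> complex \<Rightarrow> vec" where
  "kernel_vec i v z w = (if \<exists>m. w = v @ replicate m i then cnj z ^ (length w - length v) else 0)"

lemma kernel_vec_append: "kernel_vec i v z (v @ replicate m i) = cnj z ^ m"
  by (simp add: kernel_vec_def)

lemma kernel_vec_eq_0: "w \<notin> range (\<lambda>m. v @ replicate m i) \<Longrightarrow> kernel_vec i v z w = 0"
  by (auto simp: kernel_vec_def)

lemma has_sum_append_replicate: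
  assumes "\<And>w. w \<notin> range (\<lambda>m. v @ replicate m i) \<Longrightarrow> h w = 0"
  shows "(h has_sum s) UNIV \<longleftrightarrow> ((\<lambda>m. h (v @ replicate m i)) has_sum s) UNIV"
proof -
  have "inj (\<lambda>m. v @ replicate m i)" by (rule injI) (metis length_replicate same_append_eq)
  then have "(h has_sum s) (range (\<lambda>m. v @ replicate m i))
      \<longleftrightarrow> ((\<lambda>m. h (v @ replicate m i)) has_sum s) UNIV"
    by (simp add: has_sum_reindex o_def)
  moreover have "(h has_sum s) UNIV \<longleftrightarrow> (h has_sum s) (range (\<lambda>m. v @ replicate m i))"
    by (rule has_sum_cong_neutral) (use assms in auto)
  ultimately show ?thesis by simp
qed

lemma kernel_vec_norm:
  assumes "i < n" "v \<in> words n" "cmod z < 1"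
  shows kernel_vec_in_l2: "kernel_vec i v z \<in> l2 n"
    and l2norm_kernel_vec: "(l2norm (kernel_vec i v z))\<^sup>2 = 1 / (1 - (cmod z)\<^sup>2)"
proof -
  have "(\<lambda>m. ((cmod z)\<^sup>2) ^ m) sums (1 / (1 - (cmod z)\<^sup>2))"
    by (rule geometric_sums) (use assms(3) in \<open>simp add: power_less_one_iff abs_square_less_1\<close>)
  then have "((\<lambda>m. ((cmod z)\<^sup>2) ^ m) has_sum (1 / (1 - (cmod z)\<^sup>2))) UNIV"
    by (rule sums_nonneg_imp_has_sum) simp
  then have sum: "((\<lambda>w. (cmod (kernel_vec i v z w))\<^sup>2) has_sum (1 / (1 - (cmod z)\<^sup>2))) UNIV"
    by (subst has_sum_append_replicate[of v i])
      (simp_all add: kernel_vec_eq_0 kernel_vec_append norm_power power2_eq_square power_mult_distrib)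
  then show "(l2norm (kernel_vec i v z))\<^sup>2 = 1 / (1 - (cmod z)\<^sup>2)" by (simp add: l2norm_power2 infsumI)
  have "kernel_vec i v z w = 0" if "w \<notin> words n" for w
    using that assms by (intro kernel_vec_eq_0) auto
  then show "kernel_vec i v z \<in> l2 n" using sum by (auto simp: l2_def has_sum_imp_summable)
qed

lemma l2inner_kernel_vec_sums:
  assumes "\<phi> \<in> l2 n" "kernel_vec i v z \<in> l2 n"
  shows "(\<lambda>m. \<phi> (v @ replicate m i) * z ^ m) sums l2inner \<phi> (kernel_vec i v z)"
proof -
  have "((\<lambda>w. \<phi> w * cnj (kernel_vec i v z w)) has_sum l2inner \<phi> (kernel_vec i v z)) UNIV"
    unfolding l2inner_def by (rule has_sum_infsum[OF l2inner_summable[OF assms]])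
  then show ?thesis
    by (subst (asm) has_sum_append_replicate[of v i])
      (simp_all add: kernel_vec_eq_0 kernel_vec_append has_sum_imp_sums)
qed

lemma cmod_scaled_l2inner_kernel_vec_le:
  assumes i: "i < n" and v: "v \<in> words n" and z: "cmod z < 1" and \<phi>: "\<phi> \<in> l2 n"
  shows "(cmod (complex_of_real (1 - (cmod z)\<^sup>2) * l2inner \<phi> (kernel_vec i v z)))\<^sup>2
    \<le> (1 - (cmod z)\<^sup>2) * (l2norm \<phi>)\<^sup>2"
proof -
  define q where "q = 1 - (cmod z)\<^sup>2"
  let ?\<kappa> = "kernel_vec i v z"
  have q: "0 < q" using z by (simp add: q_def abs_square_less_1)
  have "(cmod (complex_of_real q * l2inner \<phi> ?\<kappa>))\<^sup>2 \<le> (q * (l2norm \<phi> * l2norm ?\<kappa>))\<^sup>2"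
    using q cmod_l2inner_le[OF \<phi> kernel_vec_in_l2[OF i v z]]
    by (intro power_mono) (simp_all add: norm_mult)
  also have "\<dots> = q * (l2norm \<phi>)\<^sup>2"
    using q by (simp add: power_mult_distrib l2norm_kernel_vec[OF i v z, folded q_def])
      (simp add: power2_eq_square)
  finally show ?thesis by (simp only: q_def)
qed

lemma l2inner_right_creation_kernel_vec:
  assumes i: "i < n" and v: "v = [] \<or> last v \<noteq> i" and \<kappa>: "kernel_vec i v z \<in> l2 n" and \<phi>: "\<phi> \<in> l2 n"
  shows "l2inner (right_creation i \<phi>) (kernel_vec i v z) = z * l2inner \<phi> (kernel_vec i v z)"
proof -
  let ?R = "right_creation i \<phi>"
  have "?R (v @ replicate 0 i) = 0" using v by (auto simp: right_creation_def)
  then have "(\<lambda>m. ?R (v @ replicate (Suc m) i) * z ^ Suc m) sums l2inner ?R (kernel_vec i v z)"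
    using l2inner_kernel_vec_sums[OF right_creation_in_l2[OF i \<phi>] \<kappa>]
      sums_Suc_iff[of "\<lambda>m. ?R (v @ replicate m i) * z ^ m"] by simp
  moreover have "?R (v @ replicate (Suc m) i) = \<phi> (v @ replicate m i)" for m
    using right_creation_simps(2)[of i \<phi> "v @ replicate m i" i] by (simp add: replicate_append_same)
  ultimately have "(\<lambda>m. z * (\<phi> (v @ replicate m i) * z ^ m)) sums l2inner ?R (kernel_vec i v z)"
    by (simp add: mult_ac)
  moreover have "(\<lambda>m. z * (\<phi> (v @ replicate m i) * z ^ m)) sums (z * l2inner \<phi> (kernel_vec i v z))"
    by (rule sums_mult[OF l2inner_kernel_vec_sums[OF \<phi> \<kappa>]])
  ultimately show ?thesis by (rule sums_unique2)
qed

lemma kernel_vec_Nil_eq: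
  "kernel_vec i [] z = (\<lambda>w. 1 * vacuum w + cnj z * right_creation i (kernel_vec i [] z) w)"
proof
  fix w
  show "kernel_vec i [] z w = 1 * vacuum w + cnj z * right_creation i (kernel_vec i [] z) w"
  proof (cases w rule: rev_cases)
    case (snoc u j)
    have "u @ [j] = replicate m i \<longleftrightarrow> (\<exists>k. m = Suc k \<and> j = i \<and> u = replicate k i)" for m
      by (cases m) (auto simp flip: replicate_append_same)
    then show ?thesis by (auto simp: snoc kernel_vec_def basis_vec_def)
  qed (simp add: kernel_vec_def basis_vec_def)
qed

abbreviation symbol :: "nat \<Rightarrow> nat list \<Rightarrow> op \<Rightarrow> complex \<Rightarrow> complex" where
  "symbol i v T z \<equiv> l2inner (T vacuum) (kernel_vec i v z)"

lemma Fn_inf_symbol_eq: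
  assumes T: "T \<in> Fn_inf n" and i: "i < n" and z: "cmod z < 1"
    and v: "v \<in> words n" "v = [] \<or> last v \<noteq> i"
  shows "symbol i v T z
    = (1 - (cmod z)\<^sup>2) * l2inner (T (kernel_vec i [] z)) (kernel_vec i v z)"
proof -
  let ?k = "kernel_vec i [] z" and ?\<kappa> = "kernel_vec i v z"
  note T' = Fn_inf_bounded_op[OF T]
  have k: "?k \<in> l2 n" and \<kappa>: "?\<kappa> \<in> l2 n" using kernel_vec_in_l2[OF i _ z] v by auto
  have Tk: "T ?k \<in> l2 n" by (rule bounded_op_in_l2[OF T' k])
  have "T ?k = T (\<lambda>w. 1 * vacuum w + cnj z * right_creation i ?k w)"
    using kernel_vec_Nil_eq by metis
  also have "\<dots> = (\<lambda>w. 1 * T vacuum w + cnj z * right_creation i (T ?k) w)"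
    by (simp only: bounded_op_lincomb[OF T' vacuum_in_l2 right_creation_in_l2[OF i k]]
        Fn_inf_right_creation[OF T k i])
  finally have "l2inner (T ?k) ?\<kappa>
      = 1 * l2inner (T vacuum) ?\<kappa> + cnj z * l2inner (right_creation i (T ?k)) ?\<kappa>"
    using l2inner_lincomb_left[OF bounded_op_in_l2[OF T' vacuum_in_l2]
        right_creation_in_l2[OF i Tk] \<kappa>, of 1 "cnj z"]
    by simp
  then show ?thesis
    unfolding l2inner_right_creation_kernel_vec[OF i v(2) \<kappa> Tk]
    by (simp add: complex_norm_square algebra_simps del: of_real_power)
qed

lemma Fn_inf_symbol_le:
  assumes T: "T \<in> Fn_inf n" and i: "i < n" and z: "cmod z < 1"
    and v: "v \<in> words n" "v = [] \<or> last v \<noteq> i"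
  shows "(cmod (symbol i v T z))\<^sup>2
    \<le> (1 - (cmod z)\<^sup>2) * (l2norm (T (kernel_vec i [] z)))\<^sup>2"
proof -
  let ?k = "kernel_vec i [] z"
  have "?k \<in> l2 n" by (rule kernel_vec_in_l2[OF i _ z]) simp
  then have Tk: "T ?k \<in> l2 n" by (rule bounded_op_in_l2[OF Fn_inf_bounded_op[OF T]])
  show ?thesis
    unfolding Fn_inf_symbol_eq[OF assms] by (rule cmod_scaled_l2inner_kernel_vec_le[OF i v(1) z Tk])
qed

lemma Fn_inf_symbol_diff_le:
  assumes A: "A \<in> Fn_inf n" and B: "B \<in> Fn_inf n" and i: "i < n" and z: "cmod z < 1"
    and v: "v \<in> words n" "v = [] \<or> last v \<noteq> i"
  shows "(cmod (symbol i v (\<lambda>\<psi> w. A \<psi> w - B \<psi> w) z))\<^sup>2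
    \<le> (1 - (cmod z)\<^sup>2) * (l2norm (\<lambda>w. A (kernel_vec i [] z) w - B (kernel_vec i [] z) w))\<^sup>2"
proof -
  let ?k = "kernel_vec i [] z" and ?\<kappa> = "kernel_vec i v z"
  note in_l2 = bounded_op_in_l2[OF Fn_inf_bounded_op[OF A]]
    bounded_op_in_l2[OF Fn_inf_bounded_op[OF B]]
  have k: "?k \<in> l2 n" and \<kappa>: "?\<kappa> \<in> l2 n" using kernel_vec_in_l2[OF i _ z] v by auto
  have "symbol i v (\<lambda>\<psi> w. A \<psi> w - B \<psi> w) z
      = of_real (1 - (cmod z)\<^sup>2) * l2inner (\<lambda>w. A ?k w - B ?k w) ?\<kappa>"
    using Fn_inf_symbol_eq[OF A i z v] Fn_inf_symbol_eq[OF B i z v]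
    by (simp add: l2inner_diff_left[OF in_l2(1)[OF vacuum_in_l2] in_l2(2)[OF vacuum_in_l2] \<kappa>]
        l2inner_diff_left[OF in_l2(1)[OF k] in_l2(2)[OF k] \<kappa>] right_diff_distrib)
  then show ?thesis
    by (simp only: cmod_scaled_l2inner_kernel_vec_le[OF i v(1) z
          l2_diff[OF in_l2(1)[OF k] in_l2(2)[OF k]]])
qed

section \<open>Extreme points\<close>

text \<open>In the definitions of extremality the weight is compared with 0 and 1 after coercion to the
  complex numbers, whose order is the one from \<open>Complex_Order\<close>.\<close>

lemma of_real_complex_unit_interval:
  "0 < complex_of_real t \<longleftrightarrow> 0 < t" "complex_of_real t < 1 \<longleftrightarrow> t < 1"
  by (auto simp: less_complex_def)

lemma extreme_Hinf_iff:
  "extreme_Hinf f \<longleftrightarrow> f \<in> Hinf_ball \<and>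
    (\<forall>g h t. g \<in> Hinf_ball \<longrightarrow> h \<in> Hinf_ball \<longrightarrow> 0 < t \<longrightarrow> t < 1 \<longrightarrow>
      f = (\<lambda>z. (1 - complex_of_real t) * g z + complex_of_real t * h z) \<longrightarrow> g = h)"
  unfolding extreme_Hinf_def of_real_complex_unit_interval by blast

lemma extreme_Hinf_convex_eq:
  assumes "extreme_Hinf f" "g \<in> Hinf_ball" "h \<in> Hinf_ball" "0 < t" "t < 1"
    and "f = (\<lambda>z. (1 - complex_of_real t) * g z + complex_of_real t * h z)"
  shows "g = h"
  using assms unfolding extreme_Hinf_iff by blast

lemma extreme_Fn_iff:
  "extreme_Fn n T \<longleftrightarrow> T \<in> Fn_ball n \<and>
    (\<forall>A B t. A \<in> Fn_ball n \<longrightarrow> B \<in> Fn_ball n \<longrightarrow> 0 < t \<longrightarrow> t < 1 \<longrightarrow>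
      T = (\<lambda>\<psi> w. (1 - complex_of_real t) * A \<psi> w + complex_of_real t * B \<psi> w) \<longrightarrow> A = B)"
  unfolding extreme_Fn_def of_real_complex_unit_interval by blast

lemma Hinf_ball_iff:
  "f \<in> Hinf_ball \<longleftrightarrow> f holomorphic_on ball 0 1 \<and>
    (\<forall>z. cmod z < 1 \<longrightarrow> cmod (f z) \<le> 1) \<and> (\<forall>z. 1 \<le> cmod z \<longrightarrow> f z = 0)"
  by (auto simp: Hinf_ball_def Hinf_def bounded_iff intro!: exI[of _ 1])

lemma Hinf_ball_imp_Hinf: "f \<in> Hinf_ball \<Longrightarrow> f \<in> Hinf"
  by (simp add: Hinf_ball_def)

lemma extreme_Hinf_perturbation_eq_0:
  assumes f: "extreme_Hinf f" and h: "h holomorphic_on ball 0 1"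
    and le: "\<And>z. cmod z < 1 \<Longrightarrow> cmod (f z) + cmod (h z) \<le> 1" and z: "cmod z < 1"
  shows "h z = 0"
proof -
  have f_ball: "f \<in> Hinf_ball" using f by (simp add: extreme_Hinf_iff)
  define g where "g s z = (if cmod z < 1 then f z + s * h z else 0)" for s z
  have g_ball: "g s \<in> Hinf_ball" if s: "cmod s = 1" for s
  proof -
    have "(\<lambda>z. f z + s * h z) holomorphic_on ball 0 1"
      using f_ball h by (auto intro!: holomorphic_intros simp: Hinf_ball_iff)
    then have "g s holomorphic_on ball 0 1" by (rule holomorphic_transform) (simp add: g_def)
    moreover have "cmod (g s z) \<le> 1" if "cmod z < 1" for z
      using norm_triangle_ineq[of "f z" "s * h z"] le[OF that] s that by (simp add: g_def norm_mult)
    ultimately show ?thesis by (simp add: Hinf_ball_iff g_def)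
  qed
  have "f = (\<lambda>z. (1 - complex_of_real (1/2)) * g 1 z + complex_of_real (1/2) * g (-1) z)"
    using f_ball by (auto simp: fun_eq_iff g_def Hinf_ball_iff field_simps)
  then have "g 1 = g (-1)"
    by (intro extreme_Hinf_convex_eq[OF f g_ball g_ball, where t="1/2"]) auto
  then have "g 1 z = g (-1) z" by (rule fun_cong)
  then show ?thesis using z by (simp add: g_def)
qed

lemma power_series_coeff_eq_0:
  fixes a :: "nat \<Rightarrow> complex"
  assumes "\<And>z. cmod z < 1 \<Longrightarrow> (\<lambda>j. a j * z ^ j) sums 0"
  shows "a j = 0"
proof -
  have "\<forall>\<^sub>F z in nhds 0. (\<lambda>j. fps_nth (Abs_fps a) j * z ^ j) sums 0"
    using assms by (auto intro!: eventually_nhds_in_open[of "ball 0 1", THEN eventually_mono])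
  then have "(\<lambda>z. 0) has_fps_expansion Abs_fps a" by (rule has_fps_expansionI)
  then have "Abs_fps a = 0" using fps_expansion_unique_complex has_fps_expansion_0 by blast
  then show ?thesis by (metis fps_nth_Abs_fps fps_zero_nth)
qed

lemma extreme_Hinf_power_series_eq_0:
  assumes f: "extreme_Hinf f" and c: "0 < c"
    and sums: "\<And>z. cmod z < 1 \<Longrightarrow> (\<lambda>j. a j * z ^ j) sums g z"
    and le: "\<And>z. cmod z < 1 \<Longrightarrow> (cmod (f z))\<^sup>2 + c * (cmod (g z))\<^sup>2 \<le> 1"
  shows "a j = 0"
proof (rule power_series_coeff_eq_0)
  let ?h = "\<lambda>z. complex_of_real (c / 2) * (g z)\<^sup>2"
  have "g holomorphic_on ball 0 1"
    by (rule power_series_holomorphic[where a=a]) (use sums in auto)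
  then have h: "?h holomorphic_on ball 0 1" by (intro holomorphic_intros)
  have "cmod (f z) + cmod (?h z) \<le> 1" if z: "cmod z < 1" for z
  proof -
    have "cmod (?h z) = c * (cmod (g z))\<^sup>2 / 2" using c by (simp add: norm_mult norm_power)
    then show ?thesis using le[OF z] sum_squares_bound[of "cmod (f z)" 1] by simp
  qed
  then have "?h z = 0" if "cmod z < 1" for z by (rule extreme_Hinf_perturbation_eq_0[OF f h _ that])
  then have "g z = 0" if "cmod z < 1" for z using that c by auto
  then show "(\<lambda>j. a j * z ^ j) sums 0" if "cmod z < 1" for z using sums[OF that] that by simp
qed

lemma Fn_ball_iff: "T \<in> Fn_ball n \<longleftrightarrow> T \<in> Fn_inf n \<and> (\<forall>\<psi>\<in>l2 n. l2norm (T \<psi>) \<le> l2norm \<psi>)"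
  using opnorm_le_1_iff[OF Fn_inf_bounded_op] by (auto simp: Fn_ball_def)

lemma Fn_ball_convex_symbol_le:
  fixes A B T :: op and t :: real
  assumes A: "A \<in> Fn_ball n" and B: "B \<in> Fn_ball n" and T: "T \<in> Fn_inf n" and t: "0 < t" "t < 1"
    and eq: "T = (\<lambda>\<psi> w. (1 - complex_of_real t) * A \<psi> w + complex_of_real t * B \<psi> w)"
    and i: "i < n" and z: "cmod z < 1" and v: "v \<in> words n" "v = [] \<or> last v \<noteq> i"
  shows "(cmod (symbol i [] T z))\<^sup>2
    + t * (1 - t) * (cmod (symbol i v (\<lambda>\<psi> w. A \<psi> w - B \<psi> w) z))\<^sup>2 \<le> 1"
    (is "?symbol_T + t * (1 - t) * ?symbol_diff \<le> 1")
proof -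
  define q where "q = 1 - (cmod z)\<^sup>2"
  let ?k = "kernel_vec i [] z"
  have q: "q > 0" using z by (simp add: q_def abs_square_less_1)
  have k: "?k \<in> l2 n" by (rule kernel_vec_in_l2[OF i _ z]) simp
  have AB: "A \<in> Fn_inf n" "B \<in> Fn_inf n" using A B by (auto simp: Fn_ball_iff)
  note ABk = AB[THEN Fn_inf_bounded_op, THEN bounded_op_in_l2, OF k]
  have "?symbol_T + t * (1 - t) * ?symbol_diff
      \<le> q * (l2norm (T ?k))\<^sup>2 + t * (1 - t) * (q * (l2norm (\<lambda>w. A ?k w - B ?k w))\<^sup>2)"
    unfolding q_def using t
    by (intro add_mono mult_left_mono Fn_inf_symbol_le[OF T i z] Fn_inf_symbol_diff_le[OF AB i z v]) auto
  also have "\<dots> = q * ((l2norm (T ?k))\<^sup>2 + t * (1 - t) * (l2norm (\<lambda>w. A ?k w - B ?k w))\<^sup>2)"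
    by (simp add: algebra_simps)
  also have "\<dots> = q * ((1 - t) * (l2norm (A ?k))\<^sup>2 + t * (l2norm (B ?k))\<^sup>2)"
    unfolding eq using l2norm_convex_power2[OF ABk, of t] by simp
  also have "\<dots> \<le> q * ((1 - t) * (l2norm ?k)\<^sup>2 + t * (l2norm ?k)\<^sup>2)"
    using A B k q t
    by (intro mult_left_mono add_mono power_mono l2norm_nonneg) (auto simp: Fn_ball_iff)
  also have "\<dots> = q * (l2norm ?k)\<^sup>2" by (simp add: algebra_simps)
  also have "\<dots> = 1" using q l2norm_kernel_vec[OF i _ z, of "[]"] by (simp add: q_def)
  finally show ?thesis .
qed

lemma fun_calc_symbol:
  assumes n: "0 < n" and f: "f \<in> Hinf" and z: "cmod z < 1"
  shows "symbol 0 [] (fun_calc n f) z = f z"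
proof (rule sums_unique2)
  have "fun_calc n f vacuum \<in> l2 n"
    by (rule bounded_op_in_l2[OF Fn_inf_bounded_op[OF fun_calc_in_Fn_inf[OF n f]] vacuum_in_l2])
  then show "(\<lambda>j. taylor_coeff f j * z ^ j) sums symbol 0 [] (fun_calc n f) z"
    using l2inner_kernel_vec_sums[of _ n 0 "[]" z] kernel_vec_in_l2[OF n _ z, of "[]"]
    by (simp flip: fun_calc_vacuum[OF n f])
qed (rule Hinf_taylor_sums[OF f z])

lemma fun_calc_in_Fn_ball_iff:
  assumes n: "0 < n" and f: "f \<in> Hinf"
  shows "fun_calc n f \<in> Fn_ball n \<longleftrightarrow> f \<in> Hinf_ball"
proof
  assume T: "fun_calc n f \<in> Fn_ball n"
  have "cmod (f z) \<le> 1" if z: "cmod z < 1" for z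
  proof -
    have "(cmod (f z))\<^sup>2 \<le> 1"
      using Fn_ball_convex_symbol_le[OF T T fun_calc_in_Fn_inf[OF n f], of "1/2" 0 z "[]"] n z
      by (simp add: fun_calc_symbol[OF n f z] l2inner_def[of "\<lambda>w. 0"] fun_eq_iff)
    then show ?thesis by (simp add: abs_square_le_1)
  qed
  then show "f \<in> Hinf_ball" using f by (auto simp: Hinf_ball_def)
next
  assume "f \<in> Hinf_ball"
  then have "disc_bounded (taylor_coeff f) 1"
    by (simp add: disc_bounded_taylor_coeff_iff[OF f] Hinf_ball_iff)
  then show "fun_calc n f \<in> Fn_ball n"
    using creation_series_in_Fn_inf[OF n] l2norm_creation_series_le[OF n]
    by (fastforce simp: Fn_ball_iff fun_calc_eq_creation_series[OF n f])
qed

lemma trail_run_cases: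
  fixes w :: "nat list"
  obtains m v where "w = v @ replicate m i" "v = [] \<or> last v \<noteq> i"
proof (rule lead_run_cases[of "rev w" i])
  fix m u assume w: "rev w = replicate m i @ u" and u: "u = [] \<or> hd u \<noteq> i"
  have "w = rev u @ replicate m i" using arg_cong[OF w, of rev] by simp
  moreover have "rev u = [] \<or> last (rev u) \<noteq> i" using u by (simp add: last_rev)
  ultimately show thesis by (rule that)
qed

lemma extreme_Hinf_convex_combination_eq:
  fixes A B :: op and t :: real
  assumes extreme: "extreme_Hinf f" and n: "0 < n" and A: "A \<in> Fn_ball n" and B: "B \<in> Fn_ball n"
    and t: "0 < t" "t < 1"
    and eq: "fun_calc n f = (\<lambda>\<psi> w. (1 - complex_of_real t) * A \<psi> w + complex_of_real t * B \<psi> w)"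
  shows "A = B"
proof (rule Fn_inf_eqI)
  show AB: "A \<in> Fn_inf n" "B \<in> Fn_inf n" using A B by (auto simp: Fn_ball_iff)
  let ?D = "\<lambda>w. A vacuum w - B vacuum w"
  have D: "?D \<in> l2 n"
    by (rule l2_diff[OF AB[THEN Fn_inf_bounded_op, THEN bounded_op_in_l2, OF vacuum_in_l2]])
  have f: "f \<in> Hinf" using extreme by (simp add: extreme_Hinf_iff Hinf_ball_imp_Hinf)
  have "?D w = 0" if w: "w \<in> words n" for w
  proof (rule trail_run_cases[of w 0])
    fix m v assume w_eq: "w = v @ replicate m 0" and v: "v = [] \<or> last v \<noteq> 0"
    have v_words: "v \<in> words n" using w w_eq by simp
    have "?D (v @ replicate m 0) = 0"
    proof (rule extreme_Hinf_power_series_eq_0[OF extreme, where a="\<lambda>j. ?D (v @ replicate j 0)"])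
      show "0 < t * (1 - t)" using t by simp
      fix z assume z: "cmod z < 1"
      show "(\<lambda>j. ?D (v @ replicate j 0) * z ^ j) sums l2inner ?D (kernel_vec 0 v z)"
        by (rule l2inner_kernel_vec_sums[OF D kernel_vec_in_l2[OF n v_words z]])
      show "(cmod (f z))\<^sup>2 + t * (1 - t) * (cmod (l2inner ?D (kernel_vec 0 v z)))\<^sup>2 \<le> 1"
        using Fn_ball_convex_symbol_le[OF A B fun_calc_in_Fn_inf[OF n f] t eq n z v_words v]
        by (simp add: fun_calc_symbol[OF n f z])
    qed
    then show "?D w = 0" by (simp add: w_eq)
  qed
  then have "A vacuum w = B vacuum w" for w
    using l2_vanishes[OF D, of w] by (cases "w \<in> words n") auto
  then show "A vacuum = B vacuum" by (rule ext)
qed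

theorem mainTheorem11:
  fixes n :: nat and f :: "complex \<Rightarrow> complex"
  assumes "n \<ge> 1" and "f \<in> Hinf"
  shows "extreme_Hinf f \<longleftrightarrow> extreme_Fn n (fun_calc n f)"
proof
  have n: "0 < n" using assms(1) by simp
  note ball_iff = fun_calc_in_Fn_ball_iff[OF n]
  show "extreme_Fn n (fun_calc n f)" if "extreme_Hinf f"
    using that extreme_Hinf_convex_combination_eq[OF that n] ball_iff[OF assms(2)]
    unfolding extreme_Fn_iff extreme_Hinf_iff by blast
  show "extreme_Hinf f" if extreme: "extreme_Fn n (fun_calc n f)"
    unfolding extreme_Hinf_iff
  proof (intro conjI allI impI)
    show "f \<in> Hinf_ball" using extreme ball_iff[OF assms(2)] by (simp add: extreme_Fn_iff)
    fix g h t
    assume g: "g \<in> Hinf_ball" and h: "h \<in> Hinf_ball" and t: "0 < t" "t < 1"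
      and eq: "f = (\<lambda>z. (1 - complex_of_real t) * g z + complex_of_real t * h z)"
    have gh: "g \<in> Hinf" "h \<in> Hinf" using g h by (simp_all add: Hinf_ball_imp_Hinf)
    have "fun_calc n f
        = (\<lambda>\<psi> w. (1 - complex_of_real t) * fun_calc n g \<psi> w + complex_of_real t * fun_calc n h \<psi> w)"
      unfolding eq by (rule fun_calc_lincomb[OF n _ gh]) (use assms(2) eq in simp)
    then have "fun_calc n g = fun_calc n h"
      using extreme t g h gh ball_iff unfolding extreme_Fn_iff by blast
    then show "g = h" by (rule fun_calc_inj[OF n gh])
  qed
qed

end
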